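(* Let $\varepsilon>0$, let $\nu\in\mathcal P(S)$, let $D\subseteq S$, and let $\mu\in\mathcal P(S)$ be an invariant measure of an accept/reject kernel $\pi_{\mathrm{a/r}}$ with accept kernel $\pi_{\mathrm a}$ and acceptance events $A(x)$, $x\in S$. Assume: (i) There exists $\rho>0$ such that for all $x,\tilde x\in D$: $\mathcal W^1_{\mathsf d}(\pi_{\mathrm a}(x,\cdot),\pi_{\mathrm a}(\tilde x,\cdot))\le(1-\rho)\,\mathsf d(x,\tilde x)$. (ii) There exist $C_{Reg},c>0$ such that for all $x,\tilde x\in D$: $\mathsf{TV}(\pi_{\mathrm a}(x,\cdot),\pi_{\mathrm a}(\tilde x,\cdot))\le C_{Reg}\,\mathsf d(x,\tilde x)+c$. (iii) There exist an epoch length $\mathfrak E\in\mathbb N$ and $b>0$ such that $$2\,\mathfrak E\,\sup_{x\in D}\mathbb P(A(x)^c)+C_{Reg}\,\mathrm{diam}_{\mathsf d}(D)\exp(-\rho(\mathfrak E-1))+b\ \le\ 1-c.$$ (iv) With $\mathfrak H=\mathfrak E\,\lceil b^{-1}\log(2/\varepsilon)\rceil$, it holds that $\mathbb P(T\le\mathfrak H)\le\varepsilon/4$ both when $X_0^{\mathrm{a/r}}\sim\nu$ and when $X_0^{\mathrm{a/r}}\sim\mu$, where $(X_k^{\mathrm{a/r}})_{k\ge0}$ is a Markov chain with transition kernel $\pi_{\mathrm{a/r}}$ and $T=\inf\{k\ge0: X_k^{\mathrm{a/r}}\notin D\}$. Then $$\inf\bigl\{n\ge0:\ \mathsf{TV}(\nu\pi_{\mathrm{a/r}}^n,\mu)\le\varepsilon\bigr\}\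 \le\ \mathfrak H.$$
   Context: $(\Omega,\mathcal A,\mathbb P)$ is a probability space, $S$ is a Polish space with metric $\mathsf d$ and Borel $\sigma$-algebra $\mathcal B$, and $\mathcal P(S)$ is the set of probability measures on $(S,\mathcal B)$. Accept/reject kernel: for Markov kernels $\pi_{\mathrm a}$ (accept kernel) and $\pi_{\mathrm r}$ (reject kernel) on $S$, a kernel $\pi_{\mathrm{a/r}}$ is an accept/reject kernel if for every $x\in S$ its transition steps $X^{\mathrm{a/r}}\sim\pi_{\mathrm{a/r}}(x,\cdot)$ have the form $$X^{\mathrm{a/r}}(\omega)=\Phi^{\mathrm a}(\omega,x)\mathbf 1_{A(x)}(\omega)+\Phi^{\mathrm r}(\omega,x)\mathbf 1_{A(x)^c}(\omega)$$ (i.e. $X^{\mathrm{a/r}}=\Phi^{\mathrm a}(\cdot,x)$ on $A(x)$ and $X^{\mathrm{a/r}}=\Phi^{\mathrm r}(\cdot,x)$ on $A(x)^c$), where $\Phi^{\mathrm a},\Phi^{\mathrm r}:\Omega\times S\to S$ are product measurable with $\Phi^{\mathrm a}(\cdot,x)\sim\pi_{\mathrm a}(x,\cdot)$, $\Phi^{\mathrm r}(\cdot,x)\sim\pi_{\mathrm r}(x,\cdot)$, and $A:S\to\mathcal A$ is measurable; $A(x)$ is the event of acceptance. $\mathsf{TV}(\nu,\eta)=\inf\mathbb P[X\ne Y]$ and $\mathcal W^1_{\mathsf d}(\nu,\eta)=\inf\mathbb E\,\mathsf d(X,Y)$, infima over all couplings $(X,Y)$ of $\nu,\eta$. $\mathrm{diam}_{\mathsf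 d}(D)=\sup_{x,y\in D}\mathsf d(x,y)$.
   Formalization: The epoch length is taken to be at least 1, the ceiling in the definition of the horizon is replaced by 0 when negative (possible only for ε > 2), and D is assumed Borel so that {T ≤ H} is an event; without these the claim can fail or be undefined. *)

theory Defs
  imports "HOL-Probability.Probability"
begin

definition markov_kernel :: "('a::polish_space \<Rightarrow> 'a measure) \<Rightarrow> bool" where
  "markov_kernel K \<longleftrightarrow> K \<in> borel \<rightarrow>\<^sub>M prob_algebra borel"

text \<open>
  The conjunct about \<open>A\<close> reads ``\<open>A\<close> is a measurable family of events'' as measurability of its
  graph in the product \<open>\<sigma>\<close>-algebra; in particular every \<open>A x\<close> is an event of \<open>M\<close>.
\<close>

definition accept_reject_kernel ::
    "'w measure \<Rightarrow> ('a::polish_space \<Rightarrow> 'a measure) \<Rightarrow> ('a \<Rightarrow> 'a measure) \<Rightarrow> ('a \<Rightarrow> 'w set)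
      \<Rightarrow> ('a \<Rightarrow> 'a measure) \<Rightarrow> bool" where
  "accept_reject_kernel M \<pi>a \<pi>r A \<pi> \<longleftrightarrow>
     markov_kernel \<pi>a \<and> markov_kernel \<pi>r \<and> markov_kernel \<pi> \<and>
     (\<forall>x. A x \<subseteq> space M) \<and>
     {p \<in> space (M \<Otimes>\<^sub>M borel). fst p \<in> A (snd p)} \<in> sets (M \<Otimes>\<^sub>M borel) \<and>
     (\<exists>\<Phi>a \<Phi>r :: 'w \<times> 'a \<Rightarrow> 'a.
        \<Phi>a \<in> M \<Otimes>\<^sub>M borel \<rightarrow>\<^sub>M borel \<and> \<Phi>r \<in> M \<Otimes>\<^sub>M borel \<rightarrow>\<^sub>M borel \<and>
        (\<forall>x. distr M borel (\<lambda>\<omega>. \<Phi>a (\<omega>, x)) = \<pi>a x \<and>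
             distr M borel (\<lambda>\<omega>. \<Phi>r (\<omega>, x)) = \<pi>r x \<and>
             distr M borel (\<lambda>\<omega>. if \<omega> \<in> A x then \<Phi>a (\<omega>, x) else \<Phi>r (\<omega>, x)) = \<pi> x))"

text \<open>
  Couplings are represented by their joint laws.
\<close>

definition couplings ::
    "'a::polish_space measure \<Rightarrow> 'a measure \<Rightarrow> ('a \<times> 'a) measure set" where
  "couplings \<nu> \<eta> =
     {\<gamma> \<in> space (prob_algebra (borel \<Otimes>\<^sub>M borel)). distr \<gamma> borel fst = \<nu> \<and> distr \<gamma> borel snd = \<eta>}"

definition TV :: "'a::polish_space measure \<Rightarrow> 'a measure \<Rightarrow> real" where
  "TV \<nu> \<eta> = (INF \<gamma>\<in>couplings \<nu> \<eta>. measure \<gamma> {p. fst p \<noteq> snd p})"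

definition W1 :: "'a::polish_space measure \<Rightarrow> 'a measure \<Rightarrow> ennreal" where
  "W1 \<nu> \<eta> = (INF \<gamma>\<in>couplings \<nu> \<eta>. \<integral>\<^sup>+p. ennreal (dist (fst p) (snd p)) \<partial>\<gamma>)"

text \<open>
  Unlike \<^const>\<open>diameter\<close>, the following is \<open>\<infinity>\<close> for unbounded sets.
\<close>

definition ediam :: "'a::metric_space set \<Rightarrow> ennreal" where
  "ediam D = (SUP x\<in>D. SUP y\<in>D. ennreal (dist x y))"

definition natural_filtration ::
    "'w measure \<Rightarrow> (nat \<Rightarrow> 'w \<Rightarrow> 'a::topological_space) \<Rightarrow> nat \<Rightarrow> 'w measure" where
  "natural_filtration N X n = sigma (space N) {X i -` B \<inter> space N | i B. i \<le> n \<and> B \<in> sets borel}"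

definition markov_chain ::
    "'w measure \<Rightarrow> ('a::polish_space \<Rightarrow> 'a measure) \<Rightarrow> 'a measure \<Rightarrow> (nat \<Rightarrow> 'w \<Rightarrow> 'a) \<Rightarrow> bool" where
  "markov_chain N K \<nu> X \<longleftrightarrow>
     prob_space N \<and> (\<forall>n. X n \<in> N \<rightarrow>\<^sub>M borel) \<and> distr N borel (X 0) = \<nu> \<and>
     (\<forall>n. \<forall>B\<in>sets borel. AE \<omega> in N.
        real_cond_exp N (natural_filtration N X n) (\<lambda>\<omega>. indicator B (X (Suc n) \<omega>)) \<omega>
          = measure (K (X n \<omega>)) B)"

definition exit_time :: "'a set \<Rightarrow> (nat \<Rightarrow> 'w \<Rightarrow> 'a) \<Rightarrow> 'w \<Rightarrow> enat" where
  "exit_time D X \<omega> = Inf {enat k | k. X k \<omega> \<notin> D}"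

definition kernel_iter :: "'a measure \<Rightarrow> ('a \<Rightarrow> 'a measure) \<Rightarrow> nat \<Rightarrow> 'a measure" where
  "kernel_iter \<nu> K n = ((\<lambda>m. m \<bind> K) ^^ n) \<nu>"

definition invariant_measure :: "('a \<Rightarrow> 'a measure) \<Rightarrow> 'a measure \<Rightarrow> bool" where
  "invariant_measure K \<mu> \<longleftrightarrow> \<mu> \<bind> K = \<mu>"

end

theory Submission
  imports Defs
begin

text \<open>
  The classical argument couples two copies of the chain: during an epoch of length \<open>E\<close> the accept
  moves contract distances for \<open>E - 1\<close> steps, and one last move, coupled for total variation, makes
  the copies coincide unless an error of probability at most \<open>1 - b\<close> has occurred. Over the epochs
  the non-coincidence probability decays like \<open>(1 - b) ^ k\<close>, and leaving \<open>D\<close> before time \<open>H\<close> is paid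
  for once, for each of the two chains. Such a coupling has to be chosen measurably in the pair of
  starting points. The proof below runs the same argument on the dual side, on test functions, where
  couplings are only used for one pair of points at a time and no measurable selection arises.

  For a test function \<open>f\<close> with values in \<open>[0, 1]\<close>, the integral of \<open>f\<close> under the law at time \<open>n\<close> is
  the integral of the \<open>n\<close>-th backward iterate of \<open>f\<close> under the initial law. If the iterates follow
  the kernel only at points of \<open>D\<close> and are arbitrary elsewhere, this identity fails by at most the
  probability of leaving \<open>D\<close> (lemma \<open>local_backward_iterate_law_error\<close>). The freedom outside \<open>D\<close> is
  what makes hypotheses that hold only on \<open>D\<close> usable. Within an epoch, the first backward step turns
  a bounded function into one that is Lipschitz on \<open>D\<close> up to a slack \<open>c\<close>; McShane's extension
  replaces it by a function that is Lipschitz on the whole space. By the elementary half of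
  Kantorovich duality, each further step multiplies the Lipschitz constant on \<open>D\<close> by \<open>exp (- \<rho>)\<close>,
  and extending again restores it on the whole space. Rejections perturb each step by at most
  their probability. Hence the values on \<open>D\<close> of the iterate after one epoch lie in an interval that is
  shorter by the factor \<open>1 - b\<close>, and so do all its values once those outside \<open>D\<close> are reset
  (lemma \<open>epoch_oscillation_contraction\<close>).

  After \<open>k\<close> epochs the iterate is constant up to \<open>(1 - b) ^ k \<le> \<epsilon> / 2\<close>, so its integrals under \<open>\<nu>\<close>
  and \<open>\<mu>\<close> differ by at most that much, and the two exit errors contribute \<open>\<epsilon> / 4\<close> each. With
  indicators as test functions this bounds the laws setwise, and a maximal coupling
  (lemma \<open>TV_le_if_setwise_le\<close>) turns the bound into one on \<open>TV\<close>.
\<close>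

section \<open>Couplings and integrals of test functions\<close>

lemma off_diagonal_measurable [measurable]:
  "{p. fst p \<noteq> snd p} \<in> sets (borel \<Otimes>\<^sub>M borel :: ('a::polish_space \<times> 'a) measure)"
proof -
  have "{p :: 'a \<times> 'a. fst p \<noteq> snd p} = - {p. \<exists>x. p = (x, x)}"
    by (auto simp: prod_eq_iff)
  moreover have "open (- {p :: 'a \<times> 'a. \<exists>x. p = (x, x)})"
    using closed_diagonal by (simp add: closed_def)
  ultimately have "open {p :: 'a \<times> 'a. fst p \<noteq> snd p}"
    by (simp only:)
  then show ?thesis
    unfolding borel_prod by (rule borel_open)
qed

lemma prob_algebra_borelD:
  assumes "\<alpha> \<in> space (prob_algebra borel)"
  shows "prob_space \<alpha>" "sets \<alpha> = sets borel" "space \<alpha> = UNIV"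
  using assms by (auto simp: space_prob_algebra dest: sets_eq_imp_space_eq)

lemma couplingsD:
  fixes \<alpha> \<beta> :: "'a::polish_space measure"
  assumes "\<gamma> \<in> couplings \<alpha> \<beta>"
  shows "prob_space \<gamma>" "sets \<gamma> = sets (borel \<Otimes>\<^sub>M borel)"
    "distr \<gamma> borel fst = \<alpha>" "distr \<gamma> borel snd = \<beta>"
  using assms by (auto simp: couplings_def space_prob_algebra)

lemma couplingsI:
  fixes \<alpha> \<beta> :: "'a::polish_space measure"
  assumes "prob_space \<gamma>" "sets \<gamma> = sets (borel \<Otimes>\<^sub>M borel)"
    "distr \<gamma> borel fst = \<alpha>" "distr \<gamma> borel snd = \<beta>"
  shows "\<gamma> \<in> couplings \<alpha> \<beta>"
  using assms by (auto simp: couplings_def space_prob_algebra)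

lemma couplings_nonempty:
  fixes \<alpha> \<beta> :: "'a::polish_space measure"
  assumes \<alpha>: "\<alpha> \<in> space (prob_algebra borel)" and \<beta>: "\<beta> \<in> space (prob_algebra borel)"
  shows "couplings \<alpha> \<beta> \<noteq> {}"
proof -
  note a = prob_algebra_borelD[OF \<alpha>] and b = prob_algebra_borelD[OF \<beta>]
  interpret A: prob_space \<alpha> by (rule a)
  interpret B: prob_space \<beta> by (rule b)
  interpret P: pair_prob_space \<alpha> \<beta> ..
  have s: "sets (\<alpha> \<Otimes>\<^sub>M \<beta>) = sets (borel \<Otimes>\<^sub>M borel)"
    by (intro sets_pair_measure_cong a b)
  have "distr (\<alpha> \<Otimes>\<^sub>M \<beta>) borel fst = \<alpha>"
    using B.distr_pair_fst[of \<alpha>] a by (simp cong: distr_cong)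
  moreover have "distr (\<alpha> \<Otimes>\<^sub>M \<beta>) borel snd = \<beta>"
  proof (rule measure_eqI)
    fix X assume "X \<in> sets (distr (\<alpha> \<Otimes>\<^sub>M \<beta>) borel snd)"
    then have X: "X \<in> sets \<beta>" by (simp add: b)
    have "emeasure (distr (\<alpha> \<Otimes>\<^sub>M \<beta>) borel snd) X = emeasure (\<alpha> \<Otimes>\<^sub>M \<beta>) (space \<alpha> \<times> X)"
      using X by (subst emeasure_distr)
        (auto simp: b a space_pair_measure s intro!: arg_cong[where f = "emeasure _"] cong: measurable_cong_sets)
    also have "\<dots> = emeasure \<beta> X"
      using X by (subst B.emeasure_pair_measure_Times) (auto simp: A.emeasure_space_1)
    finally show "emeasure (distr (\<alpha> \<Otimes>\<^sub>M \<beta>) borel snd) X = emeasure \<beta> X" .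
  qed (simp add: b)
  ultimately have "\<alpha> \<Otimes>\<^sub>M \<beta> \<in> couplings \<alpha> \<beta>"
    by (intro couplingsI P.prob_space_axioms s)
  then show ?thesis by blast
qed

lemma integral_difference_le_coupling:
  fixes f :: "'a::polish_space \<Rightarrow> real"
  assumes \<gamma>: "\<gamma> \<in> couplings \<alpha> \<beta>" and f [measurable]: "f \<in> borel_measurable borel"
    and bnd: "\<And>x. a \<le> f x" "\<And>x. f x \<le> b"
    and h: "integrable \<gamma> h" and le: "\<And>x y. f x - f y \<le> h (x, y)"
  shows "(\<integral>x. f x \<partial>\<alpha>) - (\<integral>x. f x \<partial>\<beta>) \<le> (\<integral>p. h p \<partial>\<gamma>)"
proof -
  note g = couplingsD[OF \<gamma>]
  interpret prob_space \<gamma> by (rule g)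
  note [measurable_cong] = g(2)
  have bd: "\<bar>f x\<bar> \<le> \<bar>a\<bar> + \<bar>b\<bar>" for x
    using bnd[of x] by linarith
  have i: "integrable \<gamma> (\<lambda>p. f (fst p))" "integrable \<gamma> (\<lambda>p. f (snd p))"
    by (auto intro!: integrable_const_bound[where B = "\<bar>a\<bar> + \<bar>b\<bar>"] bd)
  have "(\<integral>x. f x \<partial>\<alpha>) - (\<integral>x. f x \<partial>\<beta>) = (\<integral>p. f (fst p) - f (snd p) \<partial>\<gamma>)"
    by (simp add: g(3,4)[symmetric] integral_distr i)
  also have "\<dots> \<le> (\<integral>p. h p \<partial>\<gamma>)"
    using le by (intro integral_mono) (auto intro!: Bochner_Integration.integrable_diff i h)
  finally show ?thesis .
qed

lemma TV_dual_bound: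
  fixes f :: "'a::polish_space \<Rightarrow> real"
  assumes \<alpha>: "\<alpha> \<in> space (prob_algebra borel)" and \<beta>: "\<beta> \<in> space (prob_algebra borel)"
    and f: "f \<in> borel_measurable borel"
    and bnd: "\<And>x. a \<le> f x" "\<And>x. f x \<le> b"
    and TV: "TV \<alpha> \<beta> \<le> t"
  shows "(\<integral>x. f x \<partial>\<alpha>) - (\<integral>x. f x \<partial>\<beta>) \<le> (b - a) * t"
proof -
  have ab: "a \<le> b" using bnd[of undefined] by linarith
  have *: "(\<integral>x. f x \<partial>\<alpha>) - (\<integral>x. f x \<partial>\<beta>) \<le> (b - a) * measure \<gamma> {p. fst p \<noteq> snd p}"
    if \<gamma>: "\<gamma> \<in> couplings \<alpha> \<beta>" for \<gamma>
  proof -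
    note g = couplingsD[OF \<gamma>]
    interpret prob_space \<gamma> by (rule g)
    have sg: "{p. fst p \<noteq> snd p} \<in> sets \<gamma>"
      using g(2) by simp
    have "(\<integral>x. f x \<partial>\<alpha>) - (\<integral>x. f x \<partial>\<beta>)
        \<le> (\<integral>p. (b - a) * indicator {p. fst p \<noteq> snd p} p \<partial>\<gamma>)"
    proof (rule integral_difference_le_coupling[OF \<gamma> f bnd])
      show "integrable \<gamma> (\<lambda>p. (b - a) * indicator {p. fst p \<noteq> snd p} p)"
        using sg by (auto intro!: integrable_real_indicator simp: less_top[symmetric])
      show "f x - f y \<le> (b - a) * indicator {p. fst p \<noteq> snd p} (x, y)" for x y
        using bnd[of x] bnd[of y] by (auto simp: indicator_def)
    qed
    also have "\<dots> = (b - a) * measure \<gamma> {p. fst p \<noteq> snd p}"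
      using sg by simp
    finally show ?thesis .
  qed
  show ?thesis
  proof (cases "a = b")
    case True
    then show ?thesis using * couplings_nonempty[OF \<alpha> \<beta>] by fastforce
  next
    case False
    with ab have "((\<integral>x. f x \<partial>\<alpha>) - (\<integral>x. f x \<partial>\<beta>)) / (b - a) \<le> TV \<alpha> \<beta>"
      unfolding TV_def using *
      by (intro cINF_greatest couplings_nonempty[OF \<alpha> \<beta>]) (simp add: field_simps)
    with TV have "((\<integral>x. f x \<partial>\<alpha>) - (\<integral>x. f x \<partial>\<beta>)) / (b - a) \<le> t"
      by linarith
    with False ab show ?thesis by (simp add: field_simps)
  qed
qed

text \<open>
  This is the elementary half of Kantorovich duality: any coupling bounds the difference of
  integrals of a Lipschitz function. The boundedness of \<open>f\<close> secures integrability under all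
  probability measures.
\<close>

lemma W1_dual_bound:
  fixes f :: "'a::polish_space \<Rightarrow> real"
  assumes f: "f \<in> borel_measurable borel"
    and bnd: "\<And>x. a \<le> f x" "\<And>x. f x \<le> b"
    and lip: "\<And>x y. f x - f y \<le> L * dist x y" and L: "0 \<le> L"
    and W1: "W1 \<alpha> \<beta> \<le> ennreal w" and w: "0 \<le> w"
  shows "(\<integral>x. f x \<partial>\<alpha>) - (\<integral>x. f x \<partial>\<beta>) \<le> L * w"
proof (rule field_le_epsilon)
  fix e :: real assume e: "0 < e"
  define e' where "e' = e / (L + 1)"
  have e': "0 < e'" "L * e' \<le> e"
    using e L by (auto simp: e'_def field_simps)
  have "W1 \<alpha> \<beta> < ennreal (w + e')"
    using W1 w e'(1) by (metis ennreal_less_iff le_less_trans less_add_same_cancel1)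
  then obtain \<gamma> where \<gamma>: "\<gamma> \<in> couplings \<alpha> \<beta>"
    and le: "(\<integral>\<^sup>+p. ennreal (dist (fst p) (snd p)) \<partial>\<gamma>) < ennreal (w + e')"
    unfolding W1_def by (auto simp: INF_less_iff)
  note g = couplingsD[OF \<gamma>]
  interpret prob_space \<gamma> by (rule g)
  note [measurable_cong] = g(2)
  have m [measurable]: "(\<lambda>p. dist (fst p) (snd p)) \<in> borel_measurable \<gamma>"
    by measurable
  have i: "integrable \<gamma> (\<lambda>p. dist (fst p) (snd p))"
    using le by (intro integrableI_nonneg) (auto simp: less_top[symmetric] top_unique)
  have "ennreal (\<integral>p. dist (fst p) (snd p) \<partial>\<gamma>) < ennreal (w + e')"
    using le i by (simp add: nn_integral_eq_integral)
  then have d: "(\<integral>p. dist (fst p) (snd p) \<partial>\<gamma>) \<le> w + e'"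
    using w e' by (subst (asm) ennreal_less_iff) auto
  have "(\<integral>x. f x \<partial>\<alpha>) - (\<integral>x. f x \<partial>\<beta>) \<le> (\<integral>p. L * dist (fst p) (snd p) \<partial>\<gamma>)"
    by (rule integral_difference_le_coupling[OF \<gamma> f bnd]) (use i lip in auto)
  also have "\<dots> \<le> L * (w + e')"
    using d L by (auto intro: mult_left_mono)
  also have "\<dots> \<le> L * w + e"
    using e' by (simp add: distrib_left)
  finally show "(\<integral>x. f x \<partial>\<alpha>) - (\<integral>x. f x \<partial>\<beta>) \<le> L * w + e" .
qed


section \<open>Extending almost Lipschitz functions\<close>

text \<open>
  McShane's extension \<open>y \<mapsto> INF x\<in>D. g x + L * dist x y\<close> is Lipschitz even if \<open>g\<close> satisfies the
  Lipschitz condition only up to an additive slack \<open>c\<close>; the slack is then the price for agreeing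
  with \<open>g\<close> on \<open>D\<close>. Truncation at \<open>b\<close> keeps the range of \<open>g\<close>.
\<close>

lemma McShane_extension_with_slack:
  fixes g :: "'a::metric_space \<Rightarrow> real"
  assumes D: "D \<noteq> {}"
    and bnd: "\<And>x. x \<in> D \<Longrightarrow> a \<le> g x" "\<And>x. x \<in> D \<Longrightarrow> g x \<le> b"
    and L: "0 \<le> L" and c: "0 \<le> c"
    and lip: "\<And>x y. x \<in> D \<Longrightarrow> y \<in> D \<Longrightarrow> g x - g y \<le> L * dist x y + c"
  shows "\<exists>h. (\<forall>x y. h x - h y \<le> L * dist x y) \<and> (\<forall>x. a \<le> h x \<and> h x \<le> b) \<and>
    (\<forall>x\<in>D. h x \<le> g x \<and> g x \<le> h x + c)"
proof -
  define m where "m y = (INF x\<in>D. g x + L * dist x y)" for y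
  have bdd: "bdd_below ((\<lambda>x. g x + L * dist x y) ` D)" for y
    using bnd(1) L by (intro bdd_belowI2[of _ a]) (simp add: add_increasing2)
  have ma: "a \<le> m y" for y
    unfolding m_def using bnd(1) L by (intro cINF_greatest D) (simp add: add_increasing2)
  have mlip: "m y - m z \<le> L * dist y z" for y z
  proof -
    have "m y - L * dist y z \<le> g x + L * dist x z" if "x \<in> D" for x
    proof -
      have "m y \<le> g x + L * dist x y"
        unfolding m_def by (rule cINF_lower[OF bdd that])
      also have "\<dots> \<le> g x + L * (dist x z + dist y z)"
        using L by (intro add_left_mono mult_left_mono) (rule dist_triangle2)
      finally show ?thesis by (simp add: algebra_simps)
    qed
    then have "m y - L * dist y z \<le> m z"
      unfolding m_def[of z] by (intro cINF_greatest D)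
    then show ?thesis by simp
  qed
  have mg: "m x \<le> g x" if "x \<in> D" for x
    unfolding m_def using cINF_lower[OF bdd that, of x] by simp
  have gm: "g y \<le> m y + c" if "y \<in> D" for y
  proof -
    have "g y - c \<le> m y"
      unfolding m_def using lip[OF that] by (intro cINF_greatest D) (simp add: dist_commute algebra_simps)
    then show ?thesis by simp
  qed
  obtain z where z: "z \<in> D" using D by blast
  have ab: "a \<le> b" using bnd[OF z] by simp
  show ?thesis
  proof (intro exI[of _ "\<lambda>y. min b (m y)"] conjI allI ballI)
    fix x y :: 'a
    have "0 \<le> L * dist x y" using L by simp
    then show "min b (m x) - min b (m y) \<le> L * dist x y"
      using mlip[of x y] by (auto simp: min_def not_le)
  next
    fix x assume x: "x \<in> D"
    show "min b (m x) \<le> g x" "g x \<le> min b (m x) + c"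
      using mg[OF x] gm[OF x] bnd(2)[OF x] c by (auto simp: min_def)
  qed (use ma ab in auto)
qed

lemma one_sided_Lipschitz_measurable:
  fixes h :: "'a::metric_space \<Rightarrow> real"
  assumes lip: "\<And>x y. h x - h y \<le> L * dist x y" and L: "0 \<le> L"
  shows "h \<in> borel_measurable borel"
proof (rule borel_measurable_continuous_onI)
  have "L-lipschitz_on UNIV h"
  proof (rule lipschitz_onI)
    show "dist (h x) (h y) \<le> L * dist x y" for x y
      using lip[of x y] lip[of y x] by (simp add: dist_real_def abs_le_iff dist_commute)
  qed (rule L)
  then show "continuous_on UNIV h"
    by (rule lipschitz_on_continuous_on)
qed


section \<open>One epoch of the dual iteration\<close>

text \<open>
  Outside \<open>D\<close> every iterate but the initial function may be any measurable function with values in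
  \<open>[0, 1]\<close>; this freedom allows an iterate to be replaced there by a better behaved function.
\<close>

inductive local_backward_iterate ::
    "('a::topological_space \<Rightarrow> 'a measure) \<Rightarrow> 'a set \<Rightarrow> ('a \<Rightarrow> real) \<Rightarrow> nat \<Rightarrow> ('a \<Rightarrow> real) \<Rightarrow> bool"
  for K D f where
    start: "local_backward_iterate K D f 0 f"
  | step: "local_backward_iterate K D f n \<psi> \<Longrightarrow>
      \<psi>' \<in> borel_measurable borel \<Longrightarrow> (\<And>x. 0 \<le> \<psi>' x) \<Longrightarrow> (\<And>x. \<psi>' x \<le> 1) \<Longrightarrow>
      (\<And>x. x \<in> D \<Longrightarrow> \<psi>' x = (\<integral>y. \<psi> y \<partial>K x)) \<Longrightarrow> local_backward_iterate K D f (Suc n) \<psi>'"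

lemma local_backward_iterate_change_outside:
  assumes "local_backward_iterate K D f n \<psi>" "0 < n"
    and "\<psi>' \<in> borel_measurable borel" "\<And>x. 0 \<le> \<psi>' x" "\<And>x. \<psi>' x \<le> 1"
    and "\<And>x. x \<in> D \<Longrightarrow> \<psi>' x = \<psi> x"
  shows "local_backward_iterate K D f n \<psi>'"
  using assms by cases (auto intro: local_backward_iterate.step)

lemma markov_kernelD:
  assumes "markov_kernel K"
  shows "K x \<in> space (prob_algebra borel)" "K \<in> borel \<rightarrow>\<^sub>M subprob_algebra borel"
  using assms measurable_space[of K borel "prob_algebra borel" x]
  by (auto simp: markov_kernel_def measurable_prob_algebraD)

lemma kernel_integral_measurable:
  assumes "markov_kernel K" and [measurable]: "f \<in> borel_measurable borel"
  shows "(\<lambda>x. \<integral>y. f y \<partial>K x :: real) \<in> borel_measurable borel"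
  using markov_kernelD(2)[OF assms(1)]
  by (rule measurable_compose) (rule integral_measurable_subprob_algebra, rule assms)

lemma kernel_integral_bounds:
  fixes f :: "'a::polish_space \<Rightarrow> real"
  assumes K: "markov_kernel K" and f [measurable]: "f \<in> borel_measurable borel"
    and bnd: "\<And>x. a \<le> f x" "\<And>x. f x \<le> b"
  shows "integrable (K x) f" "a \<le> (\<integral>y. f y \<partial>K x)" "(\<integral>y. f y \<partial>K x) \<le> b"
proof -
  note k = prob_algebra_borelD[OF markov_kernelD(1)[OF K, of x]]
  interpret prob_space "K x" by (rule k)
  note [measurable_cong] = k(2)
  have bd: "\<bar>f x\<bar> \<le> \<bar>a\<bar> + \<bar>b\<bar>" for x
    using bnd[of x] by linarith
  show i: "integrable (K x) f"
    by (auto intro!: integrable_const_bound[where B = "\<bar>a\<bar> + \<bar>b\<bar>"] bd)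
  show "a \<le> (\<integral>y. f y \<partial>K x)" "(\<integral>y. f y \<partial>K x) \<le> b"
    using i bnd by (auto intro!: integral_ge_const integral_le_const)
qed

text \<open>
  \<open>Ka\<close> stands for the accept kernel and \<open>r\<close> for a bound on the rejection probabilities on \<open>D\<close>.
  The lemma \<open>TV_dual_bound\<close> is one-sided, hence the two orders in \<open>close\<close>.
\<close>

context
  fixes K Ka :: "'a::polish_space \<Rightarrow> 'a measure" and D :: "'a set" and \<kappa> C c r :: real
  assumes K: "markov_kernel K" and Ka: "markov_kernel Ka"
    and D [measurable]: "D \<in> sets borel" and D_nonempty: "D \<noteq> {}"
    and \<kappa>: "0 \<le> \<kappa>" and C: "0 \<le> C" and c: "0 \<le> c" and r: "0 \<le> r"
    and contraction: "\<And>x y. x \<in> D \<Longrightarrow> y \<in> D \<Longrightarrow> W1 (Ka x) (Ka y) \<le> ennreal (\<kappa> * dist x y)"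
    and smoothing: "\<And>x y. x \<in> D \<Longrightarrow> y \<in> D \<Longrightarrow> TV (Ka x) (Ka y) \<le> C * dist x y + c"
    and close: "\<And>x. x \<in> D \<Longrightarrow> TV (K x) (Ka x) \<le> r" "\<And>x. x \<in> D \<Longrightarrow> TV (Ka x) (K x) \<le> r"
begin

lemma integral_close:
  fixes f :: "'a \<Rightarrow> real"
  assumes "f \<in> borel_measurable borel" "\<And>x. a \<le> f x" "\<And>x. f x \<le> b" "x \<in> D"
  shows "\<bar>(\<integral>y. f y \<partial>K x) - (\<integral>y. f y \<partial>Ka x)\<bar> \<le> (b - a) * r"
  using TV_dual_bound[OF markov_kernelD(1)[OF K] markov_kernelD(1)[OF Ka] assms(1-3) close(1)[OF assms(4)]]
    TV_dual_bound[OF markov_kernelD(1)[OF Ka] markov_kernelD(1)[OF K] assms(1-3) close(2)[OF assms(4)]]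
  by (simp add: abs_le_iff)

text \<open>
  Alongside the iterate \<open>\<psi>\<close> of \<open>K\<close>, a globally Lipschitz function \<open>h\<close> is carried that follows \<open>Ka\<close>:
  a step of \<open>Ka\<close> multiplies its Lipschitz constant on \<open>D\<close> by \<open>\<kappa>\<close>, and the result is extended from \<open>D\<close>
  to the whole space. Choosing \<open>\<psi> = h\<close> outside \<open>D\<close> keeps the two functions close everywhere, hence close
  again after the next step, even though that step may leave \<open>D\<close>. The slack \<open>c\<close> enters only once,
  in the first step, and only on one side.
\<close>

lemma backward_iterate_near_Lipschitz:
  assumes f0: "local_backward_iterate K D f0 m f"
    and f: "f \<in> borel_measurable borel" "\<And>x. a \<le> f x" "\<And>x. f x \<le> b"
    and ab: "0 \<le> a" "b \<le> 1"
  shows "\<exists>\<psi> h. local_backward_iterate K D f0 (m + Suc j) \<psi> \<and>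
    \<psi> \<in> borel_measurable borel \<and> (\<forall>x. a \<le> \<psi> x \<and> \<psi> x \<le> b) \<and> (\<forall>x. a \<le> h x \<and> h x \<le> b) \<and>
    (\<forall>x y. h x - h y \<le> (b - a) * C * \<kappa> ^ j * dist x y) \<and>
    (\<forall>x. h x - (b - a) * (Suc j * r) \<le> \<psi> x \<and> \<psi> x \<le> h x + (b - a) * (c + Suc j * r))"
proof (induction j)
  case 0
  have d: "0 \<le> b - a" using f(2,3)[of undefined] by simp
  let ?g = "\<lambda>x. \<integral>y. f y \<partial>Ka x" and ?p = "\<lambda>x. \<integral>y. f y \<partial>K x"
  have lip: "?g x - ?g y \<le> (b - a) * C * dist x y + (b - a) * c" if "x \<in> D" "y \<in> D" for x y
    using TV_dual_bound[OF markov_kernelD(1)[OF Ka] markov_kernelD(1)[OF Ka] f smoothing[OF that]]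
    by (simp add: algebra_simps)
  have nn: "0 \<le> (b - a) * C" "0 \<le> (b - a) * c" using d C c by auto
  obtain h where h: "\<And>x y. h x - h y \<le> (b - a) * C * dist x y" "\<And>x. a \<le> h x" "\<And>x. h x \<le> b"
      and hg: "\<And>x. x \<in> D \<Longrightarrow> h x \<le> ?g x" "\<And>x. x \<in> D \<Longrightarrow> ?g x \<le> h x + (b - a) * c"
    using McShane_extension_with_slack[OF D_nonempty kernel_integral_bounds(2,3)[OF Ka f] nn lip] by blast
  have [measurable]: "h \<in> borel_measurable borel" "?p \<in> borel_measurable borel"
    using one_sided_Lipschitz_measurable[OF h(1)] d C kernel_integral_measurable[OF K f(1)] by auto
  \<comment> \<open>The iterate is forced on \<open>D\<close> and copies its Lipschitz companion elsewhere.\<close>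
  define \<psi> where "\<psi> x = (if x \<in> D then ?p x else h x)" for x
  have m\<psi>: "\<psi> \<in> borel_measurable borel" unfolding \<psi>_def by measurable
  have b\<psi>: "a \<le> \<psi> x" "\<psi> x \<le> b" for x
    using h kernel_integral_bounds[OF K f] by (auto simp: \<psi>_def)
  have "local_backward_iterate K D f0 (Suc m) \<psi>"
    using order_trans[OF ab(1) b\<psi>(1)] order_trans[OF b\<psi>(2) ab(2)]
    by (intro local_backward_iterate.step[OF f0] m\<psi>) (simp_all add: \<psi>_def[of x for x])
  moreover have "h x - (b - a) * r \<le> \<psi> x \<and> \<psi> x \<le> h x + (b - a) * (c + r)" for x
  proof (cases "x \<in> D")
    case True
    then show ?thesis
      using integral_close[OF f True] hg[OF True] by (auto simp: \<psi>_def abs_le_iff distrib_left)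
  next
    case False
    then show ?thesis using d c r by (auto simp: \<psi>_def)
  qed
  ultimately show ?case
    using m\<psi> b\<psi> h by (intro exI[of _ \<psi>] exI[of _ h]) simp
next
  case (Suc j)
  then obtain \<psi> h where \<psi>: "local_backward_iterate K D f0 (m + Suc j) \<psi>"
      "\<psi> \<in> borel_measurable borel" "\<And>x. a \<le> \<psi> x" "\<And>x. \<psi> x \<le> b"
    and h: "\<And>x. a \<le> h x" "\<And>x. h x \<le> b" "\<And>x y. h x - h y \<le> (b - a) * C * \<kappa> ^ j * dist x y"
    and \<psi>h: "\<And>x. h x - (b - a) * (Suc j * r) \<le> \<psi> x" "\<And>x. \<psi> x \<le> h x + (b - a) * (c + Suc j * r)"
    by blast
  have d: "0 \<le> b - a" using f(2,3)[of undefined] by simp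
  have L: "0 \<le> (b - a) * C * \<kappa> ^ j" "0 \<le> (b - a) * C * \<kappa> ^ Suc j" using d C \<kappa> by auto
  have mh: "h \<in> borel_measurable borel"
    using one_sided_Lipschitz_measurable[OF h(3) L(1)] .
  let ?g = "\<lambda>x. \<integral>y. h y \<partial>Ka x" and ?p = "\<lambda>x. \<integral>y. \<psi> y \<partial>K x"
  have lip: "?g x - ?g y \<le> (b - a) * C * \<kappa> ^ Suc j * dist x y + 0" if "x \<in> D" "y \<in> D" for x y
    using W1_dual_bound[OF mh h L(1) contraction[OF that]] \<kappa> by (simp add: algebra_simps)
  obtain h' where h': "\<And>x y. h' x - h' y \<le> (b - a) * C * \<kappa> ^ Suc j * dist x y"
      "\<And>x. a \<le> h' x" "\<And>x. h' x \<le> b"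
      and hg: "\<And>x. x \<in> D \<Longrightarrow> h' x \<le> ?g x" "\<And>x. x \<in> D \<Longrightarrow> ?g x \<le> h' x + 0"
    using McShane_extension_with_slack[OF D_nonempty kernel_integral_bounds(2,3)[OF Ka mh h(1,2)]
        L(2) order_refl lip] by blast
  have [measurable]: "h' \<in> borel_measurable borel" "?p \<in> borel_measurable borel"
    using one_sided_Lipschitz_measurable[OF h'(1) L(2)] kernel_integral_measurable[OF K \<psi>(2)] by auto
  define \<psi>' where "\<psi>' x = (if x \<in> D then ?p x else h' x)" for x
  have m\<psi>: "\<psi>' \<in> borel_measurable borel" unfolding \<psi>'_def by measurable
  have b\<psi>: "a \<le> \<psi>' x" "\<psi>' x \<le> b" for x
    using h' kernel_integral_bounds[OF K \<psi>(2-4)] by (auto simp: \<psi>'_def)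
  have "local_backward_iterate K D f0 (Suc (m + Suc j)) \<psi>'"
    using order_trans[OF ab(1) b\<psi>(1)] order_trans[OF b\<psi>(2) ab(2)]
    by (intro local_backward_iterate.step[OF \<psi>(1)] m\<psi>) (simp_all add: \<psi>'_def[of x for x])
  moreover have "h' x - (b - a) * (Suc (Suc j) * r) \<le> \<psi>' x \<and>
      \<psi>' x \<le> h' x + (b - a) * (c + Suc (Suc j) * r)" for x
  proof (cases "x \<in> D")
    case True
    interpret Kx: prob_space "Ka x"
      by (rule prob_algebra_borelD(1)[OF markov_kernelD(1)[OF Ka]])
    have i: "integrable (Ka x) h" "integrable (Ka x) \<psi>"
      using kernel_integral_bounds(1)[OF Ka] mh h \<psi> by blast+
    have "(\<integral>y. h y - (b - a) * (Suc j * r) \<partial>Ka x) \<le> (\<integral>y. \<psi> y \<partial>Ka x)"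
      using i \<psi>h(1) by (intro integral_mono) auto
    moreover have "(\<integral>y. \<psi> y \<partial>Ka x) \<le> (\<integral>y. h y + (b - a) * (c + Suc j * r) \<partial>Ka x)"
      using i \<psi>h(2) by (intro integral_mono) auto
    ultimately have "?g x - (b - a) * (Suc j * r) \<le> (\<integral>y. \<psi> y \<partial>Ka x)"
        "(\<integral>y. \<psi> y \<partial>Ka x) \<le> ?g x + (b - a) * (c + Suc j * r)"
      using i by (simp_all add: Kx.prob_space)
    moreover have "?p x - (\<integral>y. \<psi> y \<partial>Ka x) \<le> (b - a) * r" "(\<integral>y. \<psi> y \<partial>Ka x) - ?p x \<le> (b - a) * r"
      using integral_close[OF \<psi>(2-4) True] by linarith+
    ultimately show ?thesis
      using hg[OF True] True by (simp add: \<psi>'_def algebra_simps)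
  next
    case False
    then show ?thesis using d c r by (auto simp: \<psi>'_def)
  qed
  ultimately show ?case
    using m\<psi> b\<psi> h' by (intro exI[of _ \<psi>'] exI[of _ h']) simp
qed

text \<open>
  Two points of \<open>D\<close> have distance at most \<open>\<Delta>\<close>, so the Lipschitz companion of the iterate oscillates
  little on \<open>D\<close>; the terms \<open>c\<close> and \<open>2 * Suc n * r\<close> account for the distance between the two. Outside
  \<open>D\<close>, where the bound on distances is unavailable, the last iterate is overwritten by its
  infimum over \<open>D\<close>.
\<close>

lemma epoch_oscillation_contraction:
  assumes f0: "local_backward_iterate K D f0 m f"
    and f: "f \<in> borel_measurable borel" "\<And>x. a \<le> f x" "\<And>x. f x \<le> b"
    and ab: "0 \<le> a" "b \<le> 1"
    and \<Delta>: "\<And>x y. x \<in> D \<Longrightarrow> y \<in> D \<Longrightarrow> dist x y \<le> \<Delta>"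
    and q: "C * \<Delta> * \<kappa> ^ n + c + 2 * Suc n * r \<le> q"
  shows "\<exists>f' a' b'. local_backward_iterate K D f0 (m + Suc n) f' \<and> f' \<in> borel_measurable borel \<and>
    (\<forall>x. a' \<le> f' x \<and> f' x \<le> b') \<and> 0 \<le> a' \<and> b' \<le> 1 \<and> b' - a' \<le> q * (b - a)"
proof -
  obtain \<psi> h where \<psi>: "local_backward_iterate K D f0 (m + Suc n) \<psi>"
      "\<psi> \<in> borel_measurable borel" "\<And>x. a \<le> \<psi> x" "\<And>x. \<psi> x \<le> b"
    and h: "\<And>x y. h x - h y \<le> (b - a) * C * \<kappa> ^ n * dist x y"
    and \<psi>h: "\<And>x. h x - (b - a) * (Suc n * r) \<le> \<psi> x" "\<And>x. \<psi> x \<le> h x + (b - a) * (c + Suc n * r)"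
    using backward_iterate_near_Lipschitz[OF f0 f ab, of n] by blast
  have d: "0 \<le> b - a" using f(2,3)[of undefined] by simp
  have osc: "\<psi> x \<le> \<psi> y + q * (b - a)" if "x \<in> D" "y \<in> D" for x y
  proof -
    have "(b - a) * C * \<kappa> ^ n * dist x y \<le> (b - a) * C * \<kappa> ^ n * \<Delta>"
      using \<Delta>[OF that] d C \<kappa> by (intro mult_left_mono) auto
    then have "\<psi> x - \<psi> y \<le> (b - a) * (C * \<Delta> * \<kappa> ^ n + c + 2 * Suc n * r)"
      using \<psi>h(2)[of x] \<psi>h(1)[of y] h[of x y] by (simp add: algebra_simps)
    also have "\<dots> \<le> (b - a) * q"
      using q d by (rule mult_left_mono)
    finally show ?thesis by (simp add: algebra_simps)
  qed
  define a' where "a' = (INF x\<in>D. \<psi> x)"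
  define b' where "b' = (SUP x\<in>D. \<psi> x)"
  have bdd: "bdd_below (\<psi> ` D)" "bdd_above (\<psi> ` D)"
    using \<psi>(3,4) by (auto intro!: bdd_belowI2[of _ a] bdd_aboveI2[of _ _ b])
  have a': "a' \<le> \<psi> x" "\<psi> x \<le> b'" if "x \<in> D" for x
    using that unfolding a'_def b'_def by (auto intro: cINF_lower cSUP_upper bdd)
  have "a \<le> a'" "b' \<le> b"
    unfolding a'_def b'_def using D_nonempty \<psi>(3,4) by (auto intro: cINF_greatest cSUP_least)
  moreover have "b' - a' \<le> q * (b - a)"
  proof -
    have "b' - q * (b - a) \<le> \<psi> y" if "y \<in> D" for y
    proof -
      have "b' \<le> \<psi> y + q * (b - a)"
        unfolding b'_def using osc that D_nonempty by (intro cSUP_least) auto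
      then show ?thesis by simp
    qed
    then have "b' - q * (b - a) \<le> a'"
      unfolding a'_def using D_nonempty by (intro cINF_greatest)
    then show ?thesis by simp
  qed
  moreover define f' where "f' x = (if x \<in> D then \<psi> x else a')" for x
  moreover have "a' \<le> b'"
    using D_nonempty a' by (meson all_not_in_conv order_trans)
  moreover have bf': "a' \<le> f' x \<and> f' x \<le> b'" for x
    using a' \<open>a' \<le> b'\<close> by (auto simp: f'_def)
  moreover have mf': "f' \<in> borel_measurable borel"
    unfolding f'_def using \<psi>(2) by measurable
  moreover have "0 \<le> f' x" "f' x \<le> 1" for x
    using bf'[of x] \<open>a \<le> a'\<close> \<open>b' \<le> b\<close> ab by linarith+
  ultimately have "local_backward_iterate K D f0 (m + Suc n) f'"
    by (intro local_backward_iterate_change_outside[OF \<psi>(1)]) (auto simp: f'_def[of x for x])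
  then show ?thesis
    using mf' bf' order_trans[OF ab(1) \<open>a \<le> a'\<close>] order_trans[OF \<open>b' \<le> b\<close> ab(2)]
      \<open>b' - a' \<le> q * (b - a)\<close> by blast
qed

lemma epochs_oscillation_contraction:
  assumes f: "f \<in> borel_measurable borel" "\<And>x. 0 \<le> f x" "\<And>x. f x \<le> 1"
    and \<Delta>: "\<And>x y. x \<in> D \<Longrightarrow> y \<in> D \<Longrightarrow> dist x y \<le> \<Delta>"
    and q: "C * \<Delta> * \<kappa> ^ n + c + 2 * Suc n * r \<le> q" and "0 \<le> q"
  shows "\<exists>\<psi> a b. local_backward_iterate K D f (Suc n * k) \<psi> \<and> \<psi> \<in> borel_measurable borel \<and>
    (\<forall>x. a \<le> \<psi> x \<and> \<psi> x \<le> b) \<and> 0 \<le> a \<and> b \<le> 1 \<and> b - a \<le> q ^ k"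
proof (induction k)
  case 0
  show ?case
    using f by (intro exI[of _ f] exI[of _ 0] exI[of _ 1]) (auto intro: local_backward_iterate.start)
next
  case (Suc k)
  then obtain \<psi> a b where \<psi>: "local_backward_iterate K D f (Suc n * k) \<psi>"
      "\<psi> \<in> borel_measurable borel" "\<And>x. a \<le> \<psi> x" "\<And>x. \<psi> x \<le> b" "0 \<le> a" "b \<le> 1" "b - a \<le> q ^ k"
    by blast
  have "q * (b - a) \<le> q ^ Suc k"
    using \<psi>(7) \<open>0 \<le> q\<close> by (simp add: mult_left_mono)
  moreover have eq: "Suc n * Suc k = Suc n * k + Suc n" by simp
  moreover obtain \<psi>' a' b' where "local_backward_iterate K D f (Suc n * k + Suc n) \<psi>'"
      "\<psi>' \<in> borel_measurable borel" "\<forall>x. a' \<le> \<psi>' x \<and> \<psi>' x \<le> b'" "0 \<le> a'" "b' \<le> 1"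
      "b' - a' \<le> q * (b - a)"
    using epoch_oscillation_contraction[OF \<psi>(1-6) \<Delta> q] by blast
  ultimately show ?case
    unfolding eq by (meson order_trans)
qed

end


section \<open>Comparing a chain with the dual iteration\<close>

lemma natural_filtration_subalgebra:
  assumes "\<And>n. X n \<in> N \<rightarrow>\<^sub>M borel"
  shows "subalgebra N (natural_filtration N X m)"
  unfolding subalgebra_def natural_filtration_def
  using assms by (auto intro!: sets.sigma_sets_subset dest: measurable_sets simp: sets_measure_of_conv space_measure_of_conv)

lemma natural_filtration_mono:
  assumes "m \<le> n"
  shows "sets (natural_filtration N X m) \<subseteq> sets (natural_filtration N X n)"
proof -
  have eq: "sets (natural_filtration N X k)
      = sigma_sets (space N) {X i -` B \<inter> space N | i B. i \<le> k \<and> B \<in> sets borel}" for k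
    unfolding natural_filtration_def by (rule sets_measure_of) auto
  show ?thesis
    unfolding eq using assms by (intro sigma_sets_mono') (blast intro: order_trans)
qed

lemma natural_filtration_event:
  "B \<in> sets borel \<Longrightarrow> i \<le> n \<Longrightarrow> X i -` B \<inter> space N \<in> sets (natural_filtration N X n)"
  unfolding natural_filtration_def by (subst sets_measure_of) auto

text \<open>
  The Markov property with respect to the past, for laws restricted to a past event \<open>G\<close>. Stated as an
  identity of measures, it passes from indicators to all integrands at once.
\<close>

lemma markov_chain_restricted_step:
  assumes chain: "markov_chain N K \<nu> X" and K: "markov_kernel K"
    and G: "G \<in> sets (natural_filtration N X m)"
  shows "distr (density N (indicator G)) borel (X (Suc m))
    = distr (density N (indicator G)) borel (X m) \<bind> K"
proof -
  have X [measurable]: "X n \<in> N \<rightarrow>\<^sub>M borel" for n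
    using chain by (simp add: markov_chain_def)
  interpret prob_space N using chain by (simp add: markov_chain_def)
  have sub: "subalgebra N (natural_filtration N X m)"
    by (rule natural_filtration_subalgebra[OF X])
  interpret F: finite_measure_subalgebra N "natural_filtration N X m"
    by unfold_locales (rule sub)
  have GN [measurable]: "G \<in> sets N" using G sub by (auto simp: subalgebra_def)
  note Km [measurable] = markov_kernelD(2)[OF K]
  note Kx = prob_algebra_borelD[OF markov_kernelD(1)[OF K]]
  have sK: "sets (distr (density N (indicator G)) borel (X m) \<bind> K) = sets borel"
    by (rule sets_bind) (simp_all add: Kx)
  show ?thesis
  proof (rule measure_eqI)
    fix B assume "B \<in> sets (distr (density N (indicator G)) borel (X (Suc m)))"
    then have B [measurable]: "B \<in> sets borel" by simp
    have iB: "integrable N (\<lambda>\<omega>. indicator B (X (Suc m) \<omega>) :: real)"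
      by (rule integrable_const_bound[where B = 1]) (auto simp: indicator_def)
    have "emeasure (distr (density N (indicator G)) borel (X (Suc m))) B
        = (\<integral>\<^sup>+\<omega>. ennreal (indicator G \<omega> * indicator B (X (Suc m) \<omega>)) \<partial>N)"
      by (simp add: emeasure_distr emeasure_density)
         (intro nn_integral_cong, auto simp: indicator_def)
    also have "\<dots> = ennreal (\<integral>\<omega>. indicator G \<omega> * indicator B (X (Suc m) \<omega>) \<partial>N)"
      by (intro nn_integral_eq_integral integrable_const_bound[where B = 1]) (auto simp: indicator_def)
    also have "(\<integral>\<omega>. indicator G \<omega> * indicator B (X (Suc m) \<omega>) \<partial>N)
        = (\<integral>\<omega>. indicator G \<omega> * real_cond_exp N (natural_filtration N X m)
            (\<lambda>\<omega>. indicator B (X (Suc m) \<omega>)) \<omega> \<partial>N)"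
      using F.real_cond_exp_intA[OF iB G] by (simp add: set_lebesgue_integral_def)
    also have "\<dots> = (\<integral>\<omega>. indicator G \<omega> * measure (K (X m \<omega>)) B \<partial>N)"
    proof (rule integral_cong_AE)
      have "AE \<omega> in N. real_cond_exp N (natural_filtration N X m)
          (\<lambda>\<omega>. indicator B (X (Suc m) \<omega>)) \<omega> = measure (K (X m \<omega>)) B"
        using chain B unfolding markov_chain_def by blast
      then show "AE \<omega> in N. indicator G \<omega> * real_cond_exp N (natural_filtration N X m)
          (\<lambda>\<omega>. indicator B (X (Suc m) \<omega>)) \<omega> = indicator G \<omega> * measure (K (X m \<omega>)) B"
        by (rule eventually_mono) simp
      show "(\<lambda>\<omega>. indicator G \<omega> * real_cond_exp N (natural_filtration N X m)
          (\<lambda>\<omega>. indicator B (X (Suc m) \<omega>)) \<omega>) \<in> borel_measurable N"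
        by measurable
      show "(\<lambda>\<omega>. indicator G \<omega> * measure (K (X m \<omega>)) B) \<in> borel_measurable N"
        by measurable
    qed
    also have "ennreal \<dots> = (\<integral>\<^sup>+\<omega>. ennreal (indicator G \<omega> * measure (K (X m \<omega>)) B) \<partial>N)"
      using Kx(1) by (intro nn_integral_eq_integral[symmetric] integrable_const_bound[where B = 1])
        (auto simp: indicator_def prob_space.prob_le_1)
    also have "\<dots> = (\<integral>\<^sup>+\<omega>. indicator G \<omega> * emeasure (K (X m \<omega>)) B \<partial>N)"
      by (intro nn_integral_cong)
        (auto simp: indicator_def finite_measure.emeasure_eq_measure prob_space_imp_subprob_space
          subprob_space.axioms Kx(1))
    also have "\<dots> = (\<integral>\<^sup>+x. emeasure (K x) B \<partial>distr (density N (indicator G)) borel (X m))"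
      by (simp add: nn_integral_distr nn_integral_density)
    also have "\<dots> = emeasure (distr (density N (indicator G)) borel (X m) \<bind> K) B"
      using Km by (subst emeasure_bind[where N = borel]) simp_all
    finally show "emeasure (distr (density N (indicator G)) borel (X (Suc m))) B
        = emeasure (distr (density N (indicator G)) borel (X m) \<bind> K) B" .
  qed (simp add: sK)
qed

lemma markov_chain_integral_step:
  fixes \<psi> :: "'a::polish_space \<Rightarrow> real"
  assumes chain: "markov_chain N K \<nu> X" and K: "markov_kernel K"
    and G: "G \<in> sets (natural_filtration N X m)"
    and \<psi> [measurable]: "\<psi> \<in> borel_measurable borel" and bnd: "\<And>x. 0 \<le> \<psi> x" "\<And>x. \<psi> x \<le> 1"
  shows "(\<integral>\<omega>. indicator G \<omega> * \<psi> (X (Suc m) \<omega>) \<partial>N)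
    = (\<integral>\<omega>. indicator G \<omega> * (\<integral>y. \<psi> y \<partial>K (X m \<omega>)) \<partial>N)"
proof -
  have X [measurable]: "X n \<in> N \<rightarrow>\<^sub>M borel" for n
    using chain by (simp add: markov_chain_def)
  have GN [measurable]: "G \<in> sets N"
    using G natural_filtration_subalgebra[where X = X and m = m, OF X] by (auto simp: subalgebra_def)
  note [measurable] = markov_kernelD(2)[OF K] kernel_integral_measurable[OF K \<psi>]
  note kb = kernel_integral_bounds[OF K \<psi> bnd]
  let ?N = "density N (indicator G)"
  have "(\<integral>\<^sup>+\<omega>. ennreal (indicator G \<omega> * \<psi> (X (Suc m) \<omega>)) \<partial>N)
      = (\<integral>\<^sup>+x. ennreal (\<psi> x) \<partial>distr ?N borel (X (Suc m)))"
    by (simp add: nn_integral_distr nn_integral_density)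
       (intro nn_integral_cong, auto simp: indicator_def)
  also have "\<dots> = (\<integral>\<^sup>+x. \<integral>\<^sup>+y. ennreal (\<psi> y) \<partial>K x \<partial>distr ?N borel (X m))"
    unfolding markov_chain_restricted_step[OF chain K G]
    by (rule nn_integral_bind[where B = borel]) measurable
  also have "\<dots> = (\<integral>\<^sup>+x. ennreal (\<integral>y. \<psi> y \<partial>K x) \<partial>distr ?N borel (X m))"
    using bnd by (intro nn_integral_cong nn_integral_eq_integral kb) auto
  also have "\<dots> = (\<integral>\<^sup>+\<omega>. ennreal (indicator G \<omega> * (\<integral>y. \<psi> y \<partial>K (X m \<omega>))) \<partial>N)"
    by (simp add: nn_integral_distr nn_integral_density)
       (intro nn_integral_cong, auto simp: indicator_def)
  finally show ?thesis
    using bnd kb by (simp add: integral_eq_nn_integral)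
qed

lemma markov_chain_law:
  assumes chain: "markov_chain N K \<nu> X" and K: "markov_kernel K"
  shows "distr N borel (X n) = kernel_iter \<nu> K n"
proof (induction n)
  case 0
  then show ?case using chain by (simp add: markov_chain_def kernel_iter_def)
next
  case (Suc n)
  have X [measurable]: "X n \<in> N \<rightarrow>\<^sub>M borel" for n
    using chain by (simp add: markov_chain_def)
  have "density N (indicator (space N)) = N"
    by (rule measure_eqI) (auto simp: emeasure_restricted)
  moreover have "space N \<in> sets (natural_filtration N X n)"
    using natural_filtration_event[of UNIV n n X N] by simp
  ultimately have "distr N borel (X (Suc n)) = distr N borel (X n) \<bind> K"
    using markov_chain_restricted_step[OF chain K, of "space N" n] by simp
  then show ?case by (simp add: Suc kernel_iter_def)
qed

lemma local_backward_iterate_regular: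
  assumes "local_backward_iterate K D f n \<psi>"
    and "f \<in> borel_measurable borel" "\<And>x. 0 \<le> f x" "\<And>x. f x \<le> 1"
  shows "\<psi> \<in> borel_measurable borel" "0 \<le> \<psi> x" "\<psi> x \<le> 1"
  using assms by (auto elim: local_backward_iterate.cases)

text \<open>
  By the Markov property, a step taken from a point of \<open>D\<close> leaves the expectation unchanged.
  At the first exit the remaining difference is bounded by \<open>1\<close>, which is why the bound is the
  probability of one exit event instead of a sum over the times spent outside. For this, the
  induction carries the event \<open>G\<close> that the chain has not yet left \<open>D\<close>.
\<close>

lemma local_backward_iterate_error:
  fixes f :: "'a::polish_space \<Rightarrow> real"
  assumes chain: "markov_chain N K \<nu> X" and K: "markov_kernel K"
    and D [measurable]: "D \<in> sets borel"
    and f: "f \<in> borel_measurable borel" "\<And>x. 0 \<le> f x" "\<And>x. f x \<le> 1"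
    and \<psi>: "local_backward_iterate K D f n \<psi>"
    and G: "G \<in> sets (natural_filtration N X m)"
  shows "\<bar>\<integral>\<omega>. indicator G \<omega> * (f (X (m + n) \<omega>) - \<psi> (X m \<omega>)) \<partial>N\<bar>
    \<le> measure N {\<omega> \<in> G. \<exists>i<n. X (m + i) \<omega> \<notin> D}"
  using \<psi> G
proof (induction arbitrary: m G)
  case start
  then show ?case by simp
next
  case (step n \<psi> \<psi>')
  have X [measurable]: "X n \<in> N \<rightarrow>\<^sub>M borel" for n
    using chain by (simp add: markov_chain_def)
  interpret prob_space N using chain by (simp add: markov_chain_def)
  have sub: "sets (natural_filtration N X m) \<subseteq> sets N"
    using natural_filtration_subalgebra[where X = X and m = m, OF X] by (auto simp: subalgebra_def)
  then have GN [measurable]: "G \<in> sets N" using step.prems by auto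
  have Gsp: "G \<subseteq> space N" using GN by (rule sets.sets_into_space)
  define I where "I = G \<inter> (X m -` D \<inter> space N)"
  define O' where "O' = G - (X m -` D \<inter> space N)"
  have IF: "I \<in> sets (natural_filtration N X m)"
    unfolding I_def by (intro sets.Int step.prems natural_filtration_event D) simp
  have meas [measurable]: "I \<in> sets N" "O' \<in> sets N"
    unfolding I_def O'_def by measurable
  note \<psi> = local_backward_iterate_regular[OF step.hyps(1) f]
  note [measurable] = f(1) \<psi>(1) step.hyps(2) kernel_integral_measurable[OF K \<psi>(1)]
  have b01: "\<bar>u - v\<bar> \<le> 1" if "0 \<le> u" "u \<le> 1" "0 \<le> v" "v \<le> 1" for u v :: real
    using that by linarith
  have int: "integrable N (\<lambda>\<omega>. indicator H \<omega> * g \<omega>)"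
    if "H \<in> sets N" "g \<in> borel_measurable N" "\<And>\<omega>. \<bar>g \<omega>\<bar> \<le> 1" for H and g :: "_ \<Rightarrow> real"
    using that by (intro integrable_const_bound[where B = 1]) (auto simp: indicator_def)
  let ?f = "\<lambda>\<omega>. f (X (m + Suc n) \<omega>)"
  have bd1: "\<bar>?f \<omega> - \<psi>' (X m \<omega>)\<bar> \<le> 1" for \<omega>
    by (intro b01 f step.hyps)
  have bd2: "\<bar>?f \<omega> - \<psi> (X (Suc m) \<omega>)\<bar> \<le> 1" for \<omega>
    by (intro b01 f \<psi>)
  have "(\<integral>\<omega>. indicator G \<omega> * (?f \<omega> - \<psi>' (X m \<omega>)) \<partial>N)
      = (\<integral>\<omega>. indicator I \<omega> * (?f \<omega> - \<psi>' (X m \<omega>)) + indicator O' \<omega> * (?f \<omega> - \<psi>' (X m \<omega>)) \<partial>N)"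
    using Gsp by (intro Bochner_Integration.integral_cong) (auto simp: I_def O'_def indicator_def)
  also have "\<dots> = (\<integral>\<omega>. indicator I \<omega> * (?f \<omega> - \<psi>' (X m \<omega>)) \<partial>N)
      + (\<integral>\<omega>. indicator O' \<omega> * (?f \<omega> - \<psi>' (X m \<omega>)) \<partial>N)"
    using bd1 by (intro Bochner_Integration.integral_add int) auto
  also have "(\<integral>\<omega>. indicator I \<omega> * (?f \<omega> - \<psi>' (X m \<omega>)) \<partial>N)
      = (\<integral>\<omega>. indicator I \<omega> * (?f \<omega> - \<psi> (X (Suc m) \<omega>)) \<partial>N)"
  proof -
    have "(\<integral>\<omega>. indicator I \<omega> * \<psi>' (X m \<omega>) \<partial>N)
        = (\<integral>\<omega>. indicator I \<omega> * (\<integral>y. \<psi> y \<partial>K (X m \<omega>)) \<partial>N)"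
      by (intro Bochner_Integration.integral_cong) (auto simp: I_def indicator_def step.hyps(5))
    also have "\<dots> = (\<integral>\<omega>. indicator I \<omega> * \<psi> (X (Suc m) \<omega>) \<partial>N)"
      by (rule markov_chain_integral_step[OF chain K IF \<psi>, symmetric])
    finally have eq: "(\<integral>\<omega>. indicator I \<omega> * \<psi>' (X m \<omega>) \<partial>N)
        = (\<integral>\<omega>. indicator I \<omega> * \<psi> (X (Suc m) \<omega>) \<partial>N)" .
    have i: "integrable N (\<lambda>\<omega>. indicator I \<omega> * ?f \<omega>)"
        "integrable N (\<lambda>\<omega>. indicator I \<omega> * \<psi>' (X m \<omega>))"
        "integrable N (\<lambda>\<omega>. indicator I \<omega> * \<psi> (X (Suc m) \<omega>))"
      by (intro int; simp add: f step.hyps \<psi>)+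
    show ?thesis using eq i by (simp add: right_diff_distrib)
  qed
  finally have "\<bar>\<integral>\<omega>. indicator G \<omega> * (?f \<omega> - \<psi>' (X m \<omega>)) \<partial>N\<bar>
      \<le> \<bar>\<integral>\<omega>. indicator I \<omega> * (?f \<omega> - \<psi> (X (Suc m) \<omega>)) \<partial>N\<bar>
        + \<bar>\<integral>\<omega>. indicator O' \<omega> * (?f \<omega> - \<psi>' (X m \<omega>)) \<partial>N\<bar>"
    by simp
  also have "\<bar>\<integral>\<omega>. indicator I \<omega> * (?f \<omega> - \<psi> (X (Suc m) \<omega>)) \<partial>N\<bar>
      \<le> measure N {\<omega> \<in> I. \<exists>i<n. X (Suc m + i) \<omega> \<notin> D}"
    using step.IH[of I "Suc m"] IF natural_filtration_mono[of m "Suc m" N X] by auto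
  also have "\<bar>\<integral>\<omega>. indicator O' \<omega> * (?f \<omega> - \<psi>' (X m \<omega>)) \<partial>N\<bar> \<le> measure N O'"
  proof -
    have "\<bar>\<integral>\<omega>. indicator O' \<omega> * (?f \<omega> - \<psi>' (X m \<omega>)) \<partial>N\<bar>
        \<le> (\<integral>\<omega>. \<bar>indicator O' \<omega> * (?f \<omega> - \<psi>' (X m \<omega>))\<bar> \<partial>N)"
      by (rule integral_abs_bound)
    also have "\<dots> \<le> (\<integral>\<omega>. indicator O' \<omega> \<partial>N)"
      using bd1 by (intro integral_mono integrable_abs int integrable_real_indicator)
        (auto simp: indicator_def less_top[symmetric])
    finally show ?thesis by simp
  qed
  also have "measure N {\<omega> \<in> I. \<exists>i<n. X (Suc m + i) \<omega> \<notin> D} + measure N O'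
      = measure N ({\<omega> \<in> I. \<exists>i<n. X (Suc m + i) \<omega> \<notin> D} \<union> O')"
  proof (rule finite_measure_Union[symmetric])
    have "{\<omega> \<in> I. \<exists>i<n. X (Suc m + i) \<omega> \<notin> D} = I \<inter> {\<omega> \<in> space N. \<exists>i<n. X (Suc m + i) \<omega> \<notin> D}"
      using Gsp by (auto simp: I_def)
    then show "{\<omega> \<in> I. \<exists>i<n. X (Suc m + i) \<omega> \<notin> D} \<in> sets N"
      by simp
  qed (auto simp: I_def O'_def)
  also have "{\<omega> \<in> I. \<exists>i<n. X (Suc m + i) \<omega> \<notin> D} \<union> O' = {\<omega> \<in> G. \<exists>i<Suc n. X (m + i) \<omega> \<notin> D}"
    using Gsp by (auto simp: I_def O'_def less_Suc_eq_0_disj)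
  finally show ?case by simp
qed


lemma exit_time_le_iff: "exit_time D X \<omega> \<le> enat n \<longleftrightarrow> (\<exists>k\<le>n. X k \<omega> \<notin> D)"
proof -
  have "exit_time D X \<omega> \<le> enat n \<longleftrightarrow> exit_time D X \<omega> < enat (Suc n)"
    by (cases "exit_time D X \<omega>") auto
  also have "\<dots> \<longleftrightarrow> (\<exists>k\<le>n. X k \<omega> \<notin> D)"
    by (auto simp: exit_time_def Inf_less_iff less_Suc_eq_le)
  finally show ?thesis .
qed

lemma local_backward_iterate_law_error:
  fixes f :: "'a::polish_space \<Rightarrow> real"
  assumes chain: "markov_chain N K \<nu> X" and K: "markov_kernel K"
    and D [measurable]: "D \<in> sets borel"
    and f: "f \<in> borel_measurable borel" "\<And>x. 0 \<le> f x" "\<And>x. f x \<le> 1"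
    and \<psi>: "local_backward_iterate K D f n \<psi>"
  shows "\<bar>(\<integral>x. f x \<partial>kernel_iter \<nu> K n) - (\<integral>x. \<psi> x \<partial>\<nu>)\<bar>
    \<le> measure N {\<omega> \<in> space N. exit_time D X \<omega> \<le> enat n}"
proof -
  have X [measurable]: "X n \<in> N \<rightarrow>\<^sub>M borel" for n
    using chain by (simp add: markov_chain_def)
  interpret prob_space N using chain by (simp add: markov_chain_def)
  note r = local_backward_iterate_regular[OF \<psi> f]
  note [measurable] = f(1) r(1)
  have i: "integrable N (\<lambda>\<omega>. f (X n \<omega>))" "integrable N (\<lambda>\<omega>. \<psi> (X 0 \<omega>))"
    using f r by (auto intro!: integrable_const_bound[where B = 1])
  have "space N \<in> sets (natural_filtration N X 0)"
    using natural_filtration_event[of UNIV 0 0 X N] by simp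
  from local_backward_iterate_error[OF chain K D f \<psi> this]
  have "\<bar>\<integral>\<omega>. indicator (space N) \<omega> * (f (X n \<omega>) - \<psi> (X 0 \<omega>)) \<partial>N\<bar>
      \<le> measure N {\<omega> \<in> space N. \<exists>i<n. X i \<omega> \<notin> D}"
    by simp
  also have "(\<integral>\<omega>. indicator (space N) \<omega> * (f (X n \<omega>) - \<psi> (X 0 \<omega>)) \<partial>N)
      = (\<integral>\<omega>. f (X n \<omega>) - \<psi> (X 0 \<omega>) \<partial>N)"
    by (intro Bochner_Integration.integral_cong) auto
  also have "\<dots> = (\<integral>x. f x \<partial>distr N borel (X n)) - (\<integral>x. \<psi> x \<partial>distr N borel (X 0))"
    using i by (simp add: integral_distr)
  also have "distr N borel (X n) = kernel_iter \<nu> K n"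
    by (rule markov_chain_law[OF chain K])
  also have "distr N borel (X 0) = \<nu>"
    using chain by (simp add: markov_chain_def)
  also have "measure N {\<omega> \<in> space N. \<exists>i<n. X i \<omega> \<notin> D}
      \<le> measure N {\<omega> \<in> space N. exit_time D X \<omega> \<le> enat n}"
    unfolding exit_time_le_iff by (intro finite_measure_mono) (auto intro: less_imp_le)
  finally show ?thesis .
qed

lemma kernel_iter_invariant:
  "invariant_measure K \<mu> \<Longrightarrow> kernel_iter \<mu> K n = \<mu>"
  by (induction n) (simp_all add: kernel_iter_def invariant_measure_def)

lemma kernel_iter_prob:
  assumes K: "markov_kernel K" and \<nu>: "\<nu> \<in> space (prob_algebra borel)"
  shows "kernel_iter \<nu> K n \<in> space (prob_algebra borel)"
proof (induction n)
  case (Suc n)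
  have "kernel_iter \<nu> K n \<bind> K \<in> space (prob_algebra borel)"
    using measurable_bind_prob_space[OF measurable_const[OF Suc] K[unfolded markov_kernel_def],
        THEN measurable_space, of undefined "count_space UNIV"] by simp
  then show ?case by (simp add: kernel_iter_def)
qed (simp add: kernel_iter_def \<nu>)

section \<open>Rejections as a perturbation of the accept kernel\<close>

lemma TV_distr_le_prob_neq:
  fixes X Y :: "'w \<Rightarrow> 'a::polish_space"
  assumes "prob_space M" and [measurable]: "X \<in> M \<rightarrow>\<^sub>M borel" "Y \<in> M \<rightarrow>\<^sub>M borel"
  shows "TV (distr M borel X) (distr M borel Y) \<le> measure M {\<omega> \<in> space M. X \<omega> \<noteq> Y \<omega>}"
proof -
  interpret prob_space M by fact
  let ?\<gamma> = "distr M (borel \<Otimes>\<^sub>M borel) (\<lambda>\<omega>. (X \<omega>, Y \<omega>))"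
  have "?\<gamma> \<in> couplings (distr M borel X) (distr M borel Y)"
    by (intro couplingsI prob_space_distr) (auto simp: distr_distr o_def)
  moreover have "measure ?\<gamma> {p. fst p \<noteq> snd p} = measure M {\<omega> \<in> space M. X \<omega> \<noteq> Y \<omega>}"
    by (subst measure_distr) (auto intro!: arg_cong[where f = "measure M"])
  ultimately show ?thesis
    unfolding TV_def by (intro cINF_lower2[where x = ?\<gamma>]) (auto intro!: bdd_belowI[of _ 0])
qed

text \<open>
  The step of the accept/reject kernel and the accept move realising it live on the same probability
  space and differ only upon rejection.
\<close>

lemma accept_reject_TV_bound:
  fixes M :: "'w measure" and \<pi>a \<pi>r \<pi> :: "'a::polish_space \<Rightarrow> 'a measure"
  assumes M: "prob_space M" and ar: "accept_reject_kernel M \<pi>a \<pi>r A \<pi>"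
  shows "TV (\<pi> x) (\<pi>a x) \<le> measure M (space M - A x)"
    "TV (\<pi>a x) (\<pi> x) \<le> measure M (space M - A x)"
proof -
  interpret prob_space M by (rule M)
  obtain \<Phi>a \<Phi>r :: "'w \<times> 'a \<Rightarrow> 'a" where
    \<Phi> [measurable]: "\<Phi>a \<in> M \<Otimes>\<^sub>M borel \<rightarrow>\<^sub>M borel" "\<Phi>r \<in> M \<Otimes>\<^sub>M borel \<rightarrow>\<^sub>M borel"
    and law: "distr M borel (\<lambda>\<omega>. \<Phi>a (\<omega>, x)) = \<pi>a x"
      "distr M borel (\<lambda>\<omega>. if \<omega> \<in> A x then \<Phi>a (\<omega>, x) else \<Phi>r (\<omega>, x)) = \<pi> x"
    using ar unfolding accept_reject_kernel_def by blast
  have gr: "{p \<in> space (M \<Otimes>\<^sub>M borel). fst p \<in> A (snd p)} \<in> sets (M \<Otimes>\<^sub>M borel)"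
    and Asub: "A x \<subseteq> space M"
    using ar by (auto simp: accept_reject_kernel_def)
  have "(\<lambda>\<omega>. (\<omega>, x)) -` {p \<in> space (M \<Otimes>\<^sub>M borel). fst p \<in> A (snd p)} \<inter> space M \<in> sets M"
    by (rule measurable_sets[OF _ gr]) measurable
  also have "(\<lambda>\<omega>. (\<omega>, x)) -` {p \<in> space (M \<Otimes>\<^sub>M borel). fst p \<in> A (snd p)} \<inter> space M = A x"
    using Asub by (auto simp: space_pair_measure)
  finally have [measurable]: "A x \<in> sets M" .
  let ?X = "\<lambda>\<omega>. if \<omega> \<in> A x then \<Phi>a (\<omega>, x) else \<Phi>r (\<omega>, x)" and ?Y = "\<lambda>\<omega>. \<Phi>a (\<omega>, x)"
  have [measurable]: "?X \<in> M \<rightarrow>\<^sub>M borel" "?Y \<in> M \<rightarrow>\<^sub>M borel" by measurable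
  have "measure M {\<omega> \<in> space M. ?X \<omega> \<noteq> ?Y \<omega>} \<le> measure M (space M - A x)"
    by (intro finite_measure_mono) auto
  moreover have "measure M {\<omega> \<in> space M. ?Y \<omega> \<noteq> ?X \<omega>} \<le> measure M (space M - A x)"
    by (intro finite_measure_mono) auto
  ultimately show "TV (\<pi> x) (\<pi>a x) \<le> measure M (space M - A x)"
      "TV (\<pi>a x) (\<pi> x) \<le> measure M (space M - A x)"
    using TV_distr_le_prob_neq[OF M, of ?X ?Y] TV_distr_le_prob_neq[OF M, of ?Y ?X]
    unfolding law by simp_all
qed

section \<open>Maximal couplings\<close>

text \<open>
  A maximal coupling is constructed. On a Hahn set \<open>P\<close>, where \<open>\<beta> \<le> \<alpha>\<close> while \<open>\<alpha> \<le> \<beta>\<close> off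
  \<open>P\<close>, the common part of \<open>\<alpha>\<close> and \<open>\<beta>\<close> is \<open>\<beta>\<close> on \<open>P\<close> and \<open>\<alpha>\<close> off \<open>P\<close>; it is placed on the diagonal. The
  excesses \<open>\<alpha>'\<close> and \<open>\<beta>'\<close> have the same mass \<open>t\<close> and are coupled by their normalised product.
\<close>

lemma TV_le_if_setwise_le:
  fixes \<alpha> \<beta> :: "'a::polish_space measure"
  assumes \<alpha>: "\<alpha> \<in> space (prob_algebra borel)" and \<beta>: "\<beta> \<in> space (prob_algebra borel)"
    and le: "\<And>B. B \<in> sets borel \<Longrightarrow> measure \<alpha> B - measure \<beta> B \<le> e"
  shows "TV \<alpha> \<beta> \<le> e"
proof -
  note a = prob_algebra_borelD[OF \<alpha>] and b = prob_algebra_borelD[OF \<beta>]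
  interpret A: prob_space \<alpha> by (rule a)
  interpret B: prob_space \<beta> by (rule b)
  note [measurable_cong, simp] = a(2) b(2)
  obtain P where P [measurable]: "P \<in> sets borel"
    and P1: "\<And>X. X \<in> sets borel \<Longrightarrow> X \<subseteq> P \<Longrightarrow> emeasure \<beta> X \<le> emeasure \<alpha> X"
    and P2: "\<And>X. X \<in> sets borel \<Longrightarrow> X \<inter> P = {} \<Longrightarrow> emeasure \<alpha> X \<le> emeasure \<beta> X"
    using finite_unsigned_Hahn_decomposition[of \<alpha> \<beta>] A.finite_measure_axioms
      B.finite_measure_axioms by auto
  define \<alpha>' where "\<alpha>' = diff_measure (density \<alpha> (indicator P)) (density \<beta> (indicator P))"
  define \<beta>' where "\<beta>' = diff_measure (density \<beta> (indicator (- P))) (density \<alpha> (indicator (- P)))"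
  have fin: "finite_measure (density \<alpha> (indicator Q))" "finite_measure (density \<beta> (indicator Q))"
    if "Q \<in> sets borel" for Q
    using that by (auto intro!: A.finite_measure_restricted B.finite_measure_restricted)
  have s' [measurable_cong, simp]: "sets \<alpha>' = sets borel" "sets \<beta>' = sets borel"
    by (auto simp: \<alpha>'_def \<beta>'_def)
  have sp' [simp]: "space \<alpha>' = UNIV" "space \<beta>' = UNIV"
    using sets_eq_imp_space_eq[OF s'(1)] sets_eq_imp_space_eq[OF s'(2)] by simp_all
  have em\<alpha>': "emeasure \<alpha>' X = ennreal (measure \<alpha> (P \<inter> X) - measure \<beta> (P \<inter> X))"
    if X [measurable]: "X \<in> sets borel" for X
  proof -
    have "emeasure \<alpha>' X = emeasure \<alpha> (P \<inter> X) - emeasure \<beta> (P \<inter> X)"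
      unfolding \<alpha>'_def using P1
      by (subst emeasure_diff_measure) (auto intro!: fin simp: emeasure_restricted)
    then show ?thesis
      by (simp add: A.emeasure_eq_measure B.emeasure_eq_measure ennreal_minus)
  qed
  have em\<beta>': "emeasure \<beta>' X = ennreal (measure \<beta> (- P \<inter> X) - measure \<alpha> (- P \<inter> X))"
    if X [measurable]: "X \<in> sets borel" for X
  proof -
    have "emeasure \<beta>' X = emeasure \<beta> (- P \<inter> X) - emeasure \<alpha> (- P \<inter> X)"
      unfolding \<beta>'_def
      by (subst emeasure_diff_measure) (auto intro!: fin P2 simp: emeasure_restricted)
    then show ?thesis
      by (simp add: A.emeasure_eq_measure B.emeasure_eq_measure ennreal_minus)
  qed
  define t where "t = measure \<alpha> P - measure \<beta> P"
  have pos\<alpha>': "measure \<beta> (P \<inter> X) \<le> measure \<alpha> (P \<inter> X)" if [measurable]: "X \<in> sets borel" for X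
    using P1[of "P \<inter> X"] by (simp add: A.emeasure_eq_measure B.emeasure_eq_measure)
  have pos\<beta>': "measure \<alpha> (- P \<inter> X) \<le> measure \<beta> (- P \<inter> X)" if [measurable]: "X \<in> sets borel" for X
    using P2[of "- P \<inter> X"] by (auto simp: A.emeasure_eq_measure B.emeasure_eq_measure)
  have t0: "0 \<le> t" using pos\<alpha>'[of UNIV] by (simp add: t_def)
  have compl: "measure \<beta> (- P) - measure \<alpha> (- P) = t"
    using A.prob_compl[of P] B.prob_compl[of P] by (simp add: t_def a(3) b(3) Compl_eq_Diff_UNIV)
  have tot: "emeasure \<alpha>' UNIV = ennreal t" "emeasure \<beta>' UNIV = ennreal t"
    using compl by (simp_all add: em\<alpha>' em\<beta>' t_def)
  interpret A': finite_measure \<alpha>' by (rule finite_measureI) (simp add: tot)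
  interpret B': finite_measure \<beta>' by (rule finite_measureI) (simp add: tot)

  \<comment> \<open>The coupling is the sum of these three measures, formed as a bind over a counting measure.
    For \<open>t = 0\<close> the third one vanishes, by \<open>1 / 0 = 0\<close>.\<close>
  define G :: "nat \<Rightarrow> ('a \<times> 'a) measure" where
    "G i = (if i = 0 then distr (density \<alpha> (indicator (- P))) (borel \<Otimes>\<^sub>M borel) (\<lambda>x. (x, x))
            else if i = 1 then distr (density \<beta> (indicator P)) (borel \<Otimes>\<^sub>M borel) (\<lambda>x. (x, x))
            else density (\<alpha>' \<Otimes>\<^sub>M \<beta>') (\<lambda>_. ennreal (1 / t)))" for i
  have sG: "sets (G i) = sets (borel \<Otimes>\<^sub>M borel)" for i
    by (auto simp: G_def intro!: sets_pair_measure_cong)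
  have spG: "space (G i) = UNIV" for i
    using sets_eq_imp_space_eq[OF sG] by (simp add: space_pair_measure)
  have G0: "emeasure (G 0) X = ennreal (measure \<alpha> (- P \<inter> {x. (x, x) \<in> X}))"
    and G1: "emeasure (G 1) X = ennreal (measure \<beta> (P \<inter> {x. (x, x) \<in> X}))"
    and G2: "emeasure (G 2) X = ennreal (1 / t) * emeasure (\<alpha>' \<Otimes>\<^sub>M \<beta>') X"
    if X [measurable]: "X \<in> sets (borel \<Otimes>\<^sub>M borel)" for X
  proof -
    have [measurable]: "{x. (x, x) \<in> X} \<in> sets borel"
      using measurable_sets[of "\<lambda>x::'a. (x, x)" borel "borel \<Otimes>\<^sub>M borel" X] by (simp add: vimage_def)
    show "emeasure (G 0) X = ennreal (measure \<alpha> (- P \<inter> {x. (x, x) \<in> X}))"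
      by (simp add: G_def emeasure_distr emeasure_restricted A.emeasure_eq_measure a(3)
          vimage_def)
    show "emeasure (G 1) X = ennreal (measure \<beta> (P \<inter> {x. (x, x) \<in> X}))"
      by (simp add: G_def emeasure_distr emeasure_restricted B.emeasure_eq_measure b(3)
          vimage_def)
    have "X \<in> sets (\<alpha>' \<Otimes>\<^sub>M \<beta>')"
      using X by (simp cong: sets_pair_measure_cong)
    then show "emeasure (G 2) X = ennreal (1 / t) * emeasure (\<alpha>' \<Otimes>\<^sub>M \<beta>') X"
      by (simp add: G_def emeasure_density nn_integral_cmult_indicator)
  qed
  have tt: "ennreal (1 / t) * (ennreal t * ennreal s) = ennreal s"
      "ennreal (1 / t) * (ennreal s * ennreal t) = ennreal s" if "0 \<le> s" "s \<le> t" for s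
    using that t0 by (cases "t = 0"; simp add: ennreal_mult[symmetric])+
  have rect: "emeasure (\<alpha>' \<Otimes>\<^sub>M \<beta>') (X \<times> Y) = emeasure \<alpha>' X * emeasure \<beta>' Y"
    if "X \<in> sets borel" "Y \<in> sets borel" for X Y
    using that by (intro B'.emeasure_pair_measure_Times) auto
  define \<gamma> where "\<gamma> = count_space {0, 1, 2} \<bind> G"
  have U [measurable, simp]: "UNIV \<in> sets (borel \<Otimes>\<^sub>M borel :: ('a \<times> 'a) measure)"
    using sets.top[of "borel \<Otimes>\<^sub>M borel :: ('a \<times> 'a) measure"] by (simp add: space_pair_measure)
  have prob_rect: "emeasure (G 2) UNIV = ennreal t"
  proof -
    have "emeasure (G 2) (UNIV \<times> UNIV) = ennreal (1 / t) * (ennreal t * ennreal t)"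
      using rect[of UNIV UNIV] tot G2[OF U] by simp
    then show ?thesis using tt(1)[of t] t0 by simp
  qed
  have Gsub: "G i \<in> space (subprob_algebra (borel \<Otimes>\<^sub>M borel))" if "i \<in> {0, 1, 2}" for i
  proof -
    have "emeasure (G i) UNIV \<le> 1"
      using that G0[of UNIV] G1[of UNIV] prob_rect
      by (auto simp: t_def intro!: order_trans[OF diff_le_self] 
          simp: diff_le_eq add_increasing2)
    then show ?thesis
      using sG spG by (auto simp: space_subprob_algebra intro!: subprob_spaceI)
  qed
  have em\<gamma>: "emeasure \<gamma> X = emeasure (G 0) X + emeasure (G 1) X + emeasure (G 2) X"
    if "X \<in> sets (borel \<Otimes>\<^sub>M borel)" for X
    unfolding \<gamma>_def using that Gsub
    by (subst emeasure_bind[where N = "borel \<Otimes>\<^sub>M borel"])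
       (auto simp: nn_integral_count_space_finite add.assoc)
  have s\<gamma>: "sets \<gamma> = sets (borel \<Otimes>\<^sub>M borel)"
    unfolding \<gamma>_def by (rule sets_bind) (auto simp: sG)
  have sp\<gamma>: "space \<gamma> = UNIV"
    using sets_eq_imp_space_eq[OF s\<gamma>] by (simp add: space_pair_measure)
  have fst\<gamma>: "emeasure (distr \<gamma> borel fst) X = emeasure \<alpha> X" if X [measurable]: "X \<in> sets borel" for X
  proof -
    have S: "X \<times> UNIV \<in> sets (borel \<Otimes>\<^sub>M borel :: ('a \<times> 'a) measure)" by measurable
    have "emeasure (distr \<gamma> borel fst) X = emeasure \<gamma> (X \<times> UNIV)"
      by (subst emeasure_distr) (auto simp: s\<gamma> sp\<gamma> vimage_fst cong: measurable_cong_sets)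
    also have "\<dots> = ennreal (measure \<alpha> (- P \<inter> X)) + ennreal (measure \<beta> (P \<inter> X)) +
        ennreal (measure \<alpha> (P \<inter> X) - measure \<beta> (P \<inter> X))"
    proof -
      have "measure \<alpha> (P \<inter> X) - measure \<beta> (P \<inter> X) \<le> t"
        using emeasure_mono[of X UNIV \<alpha>'] t0 by (simp add: em\<alpha>'[OF X] tot)
      then have "emeasure (G 2) (X \<times> UNIV) = ennreal (measure \<alpha> (P \<inter> X) - measure \<beta> (P \<inter> X))"
        using pos\<alpha>'[OF X] unfolding G2[OF S] by (simp add: rect tot em\<alpha>' tt)
      then show ?thesis
        using em\<gamma>[OF S] G0[OF S] G1[OF S] by simp
    qed
    also have "\<dots> = ennreal (measure \<alpha> (- P \<inter> X) + measure \<alpha> (P \<inter> X))"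
      using pos\<alpha>'[OF X] by (simp flip: ennreal_plus)
    also have "measure \<alpha> (- P \<inter> X) + measure \<alpha> (P \<inter> X) = measure \<alpha> X"
      by (subst A.finite_measure_Union[symmetric]) (auto intro: arg_cong[where f = "measure \<alpha>"])
    finally show ?thesis by (simp add: A.emeasure_eq_measure)
  qed
  have snd\<gamma>: "emeasure (distr \<gamma> borel snd) X = emeasure \<beta> X" if X [measurable]: "X \<in> sets borel" for X
  proof -
    have S: "UNIV \<times> X \<in> sets (borel \<Otimes>\<^sub>M borel :: ('a \<times> 'a) measure)" by measurable
    have "emeasure (distr \<gamma> borel snd) X = emeasure \<gamma> (UNIV \<times> X)"
      by (subst emeasure_distr) (auto simp: s\<gamma> sp\<gamma> vimage_snd cong: measurable_cong_sets)
    also have "\<dots> = ennreal (measure \<alpha> (- P \<inter> X)) + ennreal (measure \<beta> (P \<inter> X)) +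
        ennreal (measure \<beta> (- P \<inter> X) - measure \<alpha> (- P \<inter> X))"
    proof -
      have "measure \<beta> (- P \<inter> X) - measure \<alpha> (- P \<inter> X) \<le> t"
        using emeasure_mono[of X UNIV \<beta>'] t0 by (simp add: em\<beta>'[OF X] tot)
      then have "emeasure (G 2) (UNIV \<times> X) = ennreal (measure \<beta> (- P \<inter> X) - measure \<alpha> (- P \<inter> X))"
        using pos\<beta>'[OF X] unfolding G2[OF S] by (simp add: rect tot em\<beta>' tt)
      then show ?thesis
        using em\<gamma>[OF S] G0[OF S] G1[OF S] by simp
    qed
    also have "\<dots> = ennreal (measure \<beta> (P \<inter> X) + measure \<beta> (- P \<inter> X))"
      using pos\<beta>'[OF X] by (simp flip: ennreal_plus)
    also have "measure \<beta> (P \<inter> X) + measure \<beta> (- P \<inter> X) = measure \<beta> X"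
      by (subst B.finite_measure_Union[symmetric]) (auto intro: arg_cong[where f = "measure \<beta>"])
    finally show ?thesis by (simp add: B.emeasure_eq_measure)
  qed
  have dfst: "distr \<gamma> borel fst = \<alpha>"
    by (rule measure_eqI) (simp_all add: fst\<gamma>)
  have dsnd: "distr \<gamma> borel snd = \<beta>"
    by (rule measure_eqI) (simp_all add: snd\<gamma>)
  have p\<gamma>: "prob_space \<gamma>"
  proof (rule prob_spaceI)
    have "emeasure \<gamma> (space \<gamma>) = emeasure (distr \<gamma> borel fst) UNIV"
      by (subst emeasure_distr) (auto simp: s\<gamma> cong: measurable_cong_sets)
    then show "emeasure \<gamma> (space \<gamma>) = 1"
      using A.emeasure_space_1 by (simp add: dfst a(3))
  qed
  interpret prob_space \<gamma> by (rule p\<gamma>)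
  have "emeasure \<gamma> {p. fst p \<noteq> snd p} \<le> ennreal t"
  proof -
    have "emeasure \<gamma> {p. fst p \<noteq> snd p} = emeasure (G 2) {p. fst p \<noteq> snd p}"
      using G0[of "{p. fst p \<noteq> snd p}"] G1[of "{p. fst p \<noteq> snd p}"] by (simp add: em\<gamma>)
    also have "\<dots> \<le> emeasure (G 2) UNIV"
      by (intro emeasure_mono) (auto simp: sG spG[symmetric])
    finally show ?thesis by (simp add: prob_rect)
  qed
  then have "measure \<gamma> {p. fst p \<noteq> snd p} \<le> t"
    using t0 by (simp add: emeasure_eq_measure)
  then have "TV \<alpha> \<beta> \<le> t"
    unfolding TV_def
    by (intro cINF_lower2[OF _ couplingsI[OF p\<gamma> s\<gamma> dfst dsnd]]) (auto intro!: bdd_belowI[of _ 0])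
  also have "t \<le> e" unfolding t_def by (rule le) measurable
  finally show ?thesis .
qed

section \<open>Mixing within the given number of epochs\<close>

theorem theorem3:
  fixes M :: "'w measure"
    and N\<^sub>\<nu> :: "'u measure" and N\<^sub>\<mu> :: "'v measure"
    and \<pi>a \<pi>r \<pi> :: "'a::polish_space \<Rightarrow> 'a measure"
    and A :: "'a \<Rightarrow> 'w set"
    and \<nu> \<mu> :: "'a measure"
    and D :: "'a set"
    and X :: "nat \<Rightarrow> 'u \<Rightarrow> 'a" and Y :: "nat \<Rightarrow> 'v \<Rightarrow> 'a"
    and \<epsilon> \<rho> C\<^sub>R c b :: real
    and E H :: nat
  assumes "prob_space M"
    and "\<epsilon> > 0"
    and "\<nu> \<in> space (prob_algebra borel)"
    and "\<mu> \<in> space (prob_algebra borel)"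
    and "D \<in> sets borel"
    and "accept_reject_kernel M \<pi>a \<pi>r A \<pi>"
    and "invariant_measure \<pi> \<mu>"
    and "\<rho> > 0"
    and "\<And>x x'. x \<in> D \<Longrightarrow> x' \<in> D \<Longrightarrow> enn2ereal (W1 (\<pi>a x) (\<pi>a x')) \<le> ereal ((1 - \<rho>) * dist x x')"
    and "C\<^sub>R > 0" and "c > 0"
    and "\<And>x x'. x \<in> D \<Longrightarrow> x' \<in> D \<Longrightarrow> TV (\<pi>a x) (\<pi>a x') \<le> C\<^sub>R * dist x x' + c"
    and "E \<ge> 1" and "b > 0"
    and "enn2ereal (2 * of_nat E * (SUP x\<in>D. emeasure M (space M - A x))
           + ennreal C\<^sub>R * ediam D * ennreal (exp (- \<rho> * (real E - 1))) + ennreal b)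
         \<le> ereal (1 - c)"
    and "H = E * nat \<lceil>inverse b * ln (2 / \<epsilon>)\<rceil>"
    and "markov_chain N\<^sub>\<nu> \<pi> \<nu> X"
    and "measure N\<^sub>\<nu> {\<omega> \<in> space N\<^sub>\<nu>. exit_time D X \<omega> \<le> enat H} \<le> \<epsilon> / 4"
    and "markov_chain N\<^sub>\<mu> \<pi> \<mu> Y"
    and "measure N\<^sub>\<mu> {\<omega> \<in> space N\<^sub>\<mu>. exit_time D Y \<omega> \<le> enat H} \<le> \<epsilon> / 4"
  shows "Inf {enat n | n. TV (kernel_iter \<nu> \<pi> n) \<mu> \<le> \<epsilon>} \<le> enat H"
proof -
  note M = assms(1) and eps = assms(2) and nu = assms(3) and mu = assms(4) and D = assms(5)
    and ar = assms(6) and inv = assms(7) and rho = assms(8) and W = assms(9) and C = assms(10)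
    and c = assms(11) and tv = assms(12) and E = assms(13) and b = assms(14) and budget = assms(15)
    and H = assms(16) and X = assms(17) and exitX = assms(18) and Y = assms(19) and exitY = assms(20)
  interpret M: prob_space M by (rule M)
  have Ka: "markov_kernel \<pi>a" and K: "markov_kernel \<pi>"
    using ar by (auto simp: accept_reject_kernel_def)
  note it_prob = kernel_iter_prob[OF K nu]
  define k where "k = nat \<lceil>inverse b * ln (2 / \<epsilon>)\<rceil>"
  define n where "n = E - 1"
  have En: "E = Suc n" using E by (simp add: n_def)
  have Hk: "H = Suc n * k" by (simp add: H k_def En)
  have "TV (kernel_iter \<nu> \<pi> H) \<mu> \<le> \<epsilon>"
  proof (rule TV_le_if_setwise_le[OF it_prob mu])
    fix B :: "'a set" assume B: "B \<in> sets borel"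
    show "measure (kernel_iter \<nu> \<pi> H) B - measure \<mu> B \<le> \<epsilon>"
    \<comment> \<open>If \<open>D\<close> is empty, the exit time is \<open>0\<close> and the exit bound forces \<open>\<epsilon> \<ge> 4\<close>.\<close>
    proof (cases "D = {}")
      case True
      interpret N: prob_space N\<^sub>\<nu> using X by (simp add: markov_chain_def)
      have "{\<omega> \<in> space N\<^sub>\<nu>. exit_time D X \<omega> \<le> enat H} = space N\<^sub>\<nu>"
        unfolding exit_time_le_iff using True by auto
      then have "1 \<le> \<epsilon> / 4" using exitX by (simp add: N.prob_space)
      moreover have "measure (kernel_iter \<nu> \<pi> H) B \<le> 1"
        using prob_algebra_borelD(1)[OF it_prob] by (rule prob_space.prob_le_1)
      moreover have "0 \<le> measure \<mu> B" by simp
      ultimately show ?thesis by linarith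
    next
      case False
      define s where "s = (SUP x\<in>D. emeasure M (space M - A x))"
      define e where "e = exp (- \<rho> * (real E - 1))"
      have fin: "2 * of_nat E * s + ennreal C\<^sub>R * ediam D * ennreal e + ennreal b \<le> ennreal (1 - c)"
        and c1: "0 \<le> 1 - c"
      proof -
        have le: "enn2ereal (2 * of_nat E * s + ennreal C\<^sub>R * ediam D * ennreal e + ennreal b) \<le> ereal (1 - c)"
          using budget by (simp add: s_def e_def)
        have "0 \<le> ereal (1 - c)"
          by (rule order_trans[OF enn2ereal_nonneg le])
        then show "0 \<le> 1 - c" by simp
        then show "2 * of_nat E * s + ennreal C\<^sub>R * ediam D * ennreal e + ennreal b \<le> ennreal (1 - c)"
          using le by (simp add: less_eq_ennreal.rep_eq enn2ereal_ennreal)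
      qed
      have e0: "0 < e" by (simp add: e_def)
      have "s \<le> 1" unfolding s_def by (intro SUP_least M.emeasure_le_1)
      then have "s < top" by (rule order.strict_trans1) simp
      then obtain r where r: "0 \<le> r" "s = ennreal r"
        by (cases s) auto
      have "ennreal C\<^sub>R * ediam D * ennreal e < top"
        using fin by (intro order.strict_trans1[OF _ ennreal_less_top[of "1 - c"]])
          (auto intro: order_trans[rotated] add_increasing add_increasing2)
      then have "ediam D \<noteq> top"
        using C e0 by (auto simp: ennreal_mult_top ennreal_top_mult)
      then obtain \<Delta> where \<Delta>0: "0 \<le> \<Delta>" "ediam D = ennreal \<Delta>"
        by (cases "ediam D") auto
      have "ennreal (2 * real E * r + C\<^sub>R * \<Delta> * e + b) \<le> ennreal (1 - c)"
        using fin r \<Delta>0 C e0 b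
        by (simp add: ennreal_of_nat_eq_real_of_nat ennreal_mult ennreal_plus)
      then have q: "C\<^sub>R * \<Delta> * e + c + 2 * E * r \<le> 1 - b"
        using c1 by (simp add: ennreal_le_iff)
      have \<Delta>: "dist x y \<le> \<Delta>" if "x \<in> D" "y \<in> D" for x y
      proof -
        have "ennreal (dist x y) \<le> ediam D"
          unfolding ediam_def using that by (meson SUP_upper2 order_refl)
        then show ?thesis using \<Delta>0 by simp
      qed
      have rej: "measure M (space M - A x) \<le> r" if "x \<in> D" for x
      proof -
        have "emeasure M (space M - A x) \<le> s" unfolding s_def by (rule SUP_upper[OF that])
        then show ?thesis using r by (simp add: M.emeasure_eq_measure)
      qed
      have contr: "W1 (\<pi>a x) (\<pi>a y) \<le> ennreal (exp (- \<rho>) * dist x y)" if xy: "x \<in> D" "y \<in> D" for x y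
      proof -
        \<comment> \<open>Unlike \<open>1 - \<rho>\<close>, the factor \<open>exp (- \<rho>)\<close> is never negative.\<close>
        have "(1 - \<rho>) * dist x y \<le> exp (- \<rho>) * dist x y"
          using exp_ge_add_one_self[of "- \<rho>"] by (intro mult_right_mono) auto
        then have "enn2ereal (W1 (\<pi>a x) (\<pi>a y)) \<le> ereal (exp (- \<rho>) * dist x y)"
          using order_trans[OF W[OF xy]] by simp
        then show ?thesis
          by (simp add: less_eq_ennreal.rep_eq enn2ereal_ennreal)
      qed
      have close: "TV (\<pi> x) (\<pi>a x) \<le> r" "TV (\<pi>a x) (\<pi> x) \<le> r" if "x \<in> D" for x
        using accept_reject_TV_bound[OF M ar, of x] rej[OF that] by linarith+
      have ek: "exp (- \<rho>) ^ n = e"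
        by (simp add: e_def En exp_of_nat_mult[symmetric] mult.commute)
      have q0: "0 \<le> 1 - b"
        using q C \<Delta>0 e0 c r by (smt (verit) mult_nonneg_nonneg of_nat_0_le_iff)
      have qn: "C\<^sub>R * \<Delta> * exp (- \<rho>) ^ n + c + 2 * Suc n * r \<le> 1 - b"
        using q by (simp add: ek En)
      let ?f = "indicator B :: 'a \<Rightarrow> real"
      have f: "?f \<in> borel_measurable borel" "\<And>x. 0 \<le> ?f x" "\<And>x. ?f x \<le> 1"
        using B by (auto simp: indicator_def)
      obtain \<psi> lo hi where \<psi>: "local_backward_iterate \<pi> D ?f H \<psi>" "\<psi> \<in> borel_measurable borel"
          "\<And>x. lo \<le> \<psi> x" "\<And>x. \<psi> x \<le> hi" "hi - lo \<le> (1 - b) ^ k"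
        using epochs_oscillation_contraction[OF K Ka D False exp_ge_zero less_imp_le[OF C]
            less_imp_le[OF c] r(1) contr tv close f \<Delta> qn q0, of k]
        unfolding Hk by blast
      have int: "(\<integral>x. ?f x \<partial>\<alpha>) = measure \<alpha> B" if "\<alpha> \<in> space (prob_algebra borel)" for \<alpha>
        using prob_algebra_borelD[OF that] B by simp
      have 1: "measure (kernel_iter \<nu> \<pi> H) B \<le> (\<integral>x. \<psi> x \<partial>\<nu>) + \<epsilon> / 4"
        using local_backward_iterate_law_error[OF X K D f \<psi>(1)] exitX
        unfolding int[OF it_prob] by linarith
      have 2: "(\<integral>x. \<psi> x \<partial>\<mu>) - \<epsilon> / 4 \<le> measure \<mu> B"
        using local_backward_iterate_law_error[OF Y K D f \<psi>(1)] exitY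
        unfolding kernel_iter_invariant[OF inv] int[OF mu] by linarith
      have 3: "(\<integral>x. \<psi> x \<partial>\<nu>) - (\<integral>x. \<psi> x \<partial>\<mu>) \<le> hi - lo"
      proof -
        note n = prob_algebra_borelD[OF nu] and m = prob_algebra_borelD[OF mu]
        interpret nu: prob_space \<nu> by (rule n)
        interpret mu: prob_space \<mu> by (rule m)
        have bd: "\<bar>\<psi> x\<bar> \<le> \<bar>lo\<bar> + \<bar>hi\<bar>" for x
          using \<psi>(3,4)[of x] by linarith
        have "integrable \<nu> \<psi>"
          using bd \<psi>(2) n(2) by (intro nu.integrable_const_bound[where B = "\<bar>lo\<bar> + \<bar>hi\<bar>"])
            (auto cong: measurable_cong_sets)
        then have "(\<integral>x. \<psi> x \<partial>\<nu>) \<le> hi" using \<psi> by (intro nu.integral_le_const) auto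
        moreover have "integrable \<mu> \<psi>"
          using bd \<psi>(2) m(2) by (intro mu.integrable_const_bound[where B = "\<bar>lo\<bar> + \<bar>hi\<bar>"])
            (auto cong: measurable_cong_sets)
        then have "lo \<le> (\<integral>x. \<psi> x \<partial>\<mu>)" using \<psi> by (intro mu.integral_ge_const) auto
        ultimately show ?thesis by simp
      qed
      have 4: "(1 - b) ^ k \<le> \<epsilon> / 2"
      proof -
        have "(1 - b) ^ k \<le> exp (- b) ^ k"
          using exp_ge_add_one_self[of "- b"] q0 by (intro power_mono) auto
        also have "\<dots> = exp (- (b * k))"
          by (simp add: exp_of_nat_mult[symmetric] mult.commute)
        also have "\<dots> \<le> exp (- ln (2 / \<epsilon>))"
        proof -
          have "inverse b * ln (2 / \<epsilon>) \<le> k"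
            unfolding k_def by (rule real_nat_ceiling_ge)
          then have "ln (2 / \<epsilon>) \<le> b * k" using b by (simp add: field_simps)
          then show ?thesis by simp
        qed
        also have "\<dots> = \<epsilon> / 2" using eps by (simp add: exp_minus)
        finally show ?thesis .
      qed
      show ?thesis using 1 2 3 4 \<psi>(5) by linarith
    qed
  qed
  then show ?thesis by (intro Inf_lower) auto
qed

end
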